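(* Let $\Gamma$ be the Euler Gamma function. The extended plane $\widehat{\mathbb{C}}$ can be written as a union $\widehat{\mathbb{C}}=\bigcup_{n=-\infty}^{\infty}\overline{\Omega}_n$, where the $\Omega_n$ ($n\in\mathbb{Z}$) are unbounded simply connected domains such that, for every $n\in\mathbb{Z}$, $\Gamma$ maps $\Omega_n$ conformally (that is, bijectively and conformally) onto $\widehat{\mathbb{C}}\setminus L_n$, where $L_n$ is a slit alongside the real axis. The domains $\Omega_n$ accumulate to infinity and only there. Moreover, for every $n$ the mapping $\Gamma:\overline{\Omega}_n\to\widehat{\mathbb{C}}\setminus\{0\}$ is surjective.
   Context: $\widehat{\mathbb{C}}=\mathbb{C}\cup\{\infty\}$ is the Riemann sphere, and $\overline{\Omega}_n$ denotes the closure of $\Omega_n$ in $\widehat{\mathbb{C}}$. The Gamma function is regarded as a meromorphic function on $\mathbb{C}$ with values in $\widehat{\mathbb{C}}$ (value $\infty$ at its poles $0,-1,-2,\dots$); it has no zeros. A slit alongside the real axis is an arc contained in $\mathbb{R}\cup\{\infty\}$. "The domains accumulate to infinity and only there" means: every neighborhood of $\infty$ contains infinitely many of the domains, and every compact subset of $\mathbb{C}$ intersects only finitely many of them.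
   Formalization: Γ has no value at ∞, which lies in every closure; so surjectivity is read thus: each value other than 0, ∞ is taken at a finite point of the closure, and ∞ is taken at a pole in the closure or is the limit of Γ along a path in the domain tending to ∞. *)

theory Defs
  imports "HOL-Analysis.Analysis"
begin

text \<open>The Riemann sphere is the one-point compactification of the complex plane:
  \<open>None\<close> is the point at infinity, \<open>Some z\<close> the finite point \<open>z\<close>.\<close>

abbreviation riemann_sphere :: "complex option topology" where
  "riemann_sphere \<equiv> Alexandroff_compactification euclidean"

abbreviation sphere_closure :: "complex set \<Rightarrow> complex option set" where
  "sphere_closure U \<equiv> riemann_sphere closure_of (Some ` U)"

text \<open>The library function \<open>Gamma\<close> takes the junk value 0 at its poles, which are replaced
  here by infinity.\<close>

definition Gamma_sphere :: "complex \<Rightarrow> complex option" where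
  "Gamma_sphere z = (if z \<in> \<int>\<^sub>\<le>\<^sub>0 then None else Some (Gamma z))"

fun sphere_inverse :: "complex option \<Rightarrow> complex option" where
  "sphere_inverse None = Some 0"
| "sphere_inverse (Some w) = (if w = 0 then None else Some (inverse w))"

text \<open>Conformality at a point of a sphere-valued map, expressed in the chart \<open>w\<close> around a finite
  value and in the chart \<open>1/w\<close> around infinity: in that chart the map is holomorphic near \<open>z\<close>
  with nonvanishing derivative at \<open>z\<close>.\<close>

definition conformal_to_sphere_at :: "(complex \<Rightarrow> complex option) \<Rightarrow> complex \<Rightarrow> bool" where
  "conformal_to_sphere_at f z \<longleftrightarrow>
     (\<exists>g. g analytic_on {z} \<and> deriv g z \<noteq> 0 \<and>
          (if f z = None
           then \<forall>\<^sub>F x in nhds z. sphere_inverse (f x) = Some (g x)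
           else \<forall>\<^sub>F x in nhds z. f x = Some (g x)))"

definition maps_conformally_onto ::
    "(complex \<Rightarrow> complex option) \<Rightarrow> complex set \<Rightarrow> complex option set \<Rightarrow> bool" where
  "maps_conformally_onto f U V \<longleftrightarrow>
     bij_betw f U V \<and> (\<forall>z\<in>U. conformal_to_sphere_at f z)"

text \<open>The library's \<open>arc\<close> needs a topological type class, so arcs on the sphere are given as
  injective paths with respect to the topology \<open>riemann_sphere\<close>.\<close>

definition real_slit :: "complex option set \<Rightarrow> bool" where
  "real_slit L \<longleftrightarrow>
     (\<exists>g. pathin riemann_sphere g \<and> inj_on g {0..1} \<and> L = g ` {0..1}) \<and>
     L \<subseteq> insert None (Some ` \<real>)"

text \<open>The value \<open>w\<close> is a boundary value of \<open>f\<close> at infinity, taken along a path inside \<open>U\<close>.\<close>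

definition asymptotic_value_in ::
    "(complex \<Rightarrow> complex option) \<Rightarrow> complex set \<Rightarrow> complex option \<Rightarrow> bool" where
  "asymptotic_value_in f U w \<longleftrightarrow>
     (\<exists>\<gamma>::real \<Rightarrow> complex. continuous_on {0..} \<gamma> \<and> \<gamma> ` {0..} \<subseteq> U \<and>
        filterlim \<gamma> at_infinity at_top \<and>
        limitin riemann_sphere (\<lambda>t. f (\<gamma> t)) w at_top)"

text \<open>Surjectivity of \<open>Gamma\<close> from the closure of \<open>U\<close> in the sphere onto the sphere without 0.
  Every value other than 0 and infinity is attained at a finite point of the closure, where
  \<open>Gamma\<close> is defined. The value infinity is attained either at a pole in the closure or at the
  point at infinity of the closure; as \<open>Gamma\<close> has no value there, the latter means as an
  asymptotic value inside \<open>U\<close>. This cannot be avoided: if infinity lies on the slit omitted by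
  \<open>Gamma ` U\<close>, the closure need not contain a pole.\<close>

definition Gamma_surjective_on_closure :: "complex set \<Rightarrow> bool" where
  "Gamma_surjective_on_closure U \<longleftrightarrow>
     (\<forall>z. Some z \<in> sphere_closure U \<longrightarrow> Gamma_sphere z \<in> UNIV - {Some 0}) \<and>
     (\<forall>w \<in> UNIV - {Some 0}.
        (\<exists>z. Some z \<in> sphere_closure U \<and> Gamma_sphere z = w) \<or>
        (w = None \<and> None \<in> sphere_closure U \<and> asymptotic_value_in Gamma_sphere U None))"

end

theory Submission
  imports Defs
begin

text \<open>On the upper half plane \<open>H\<close> the function \<open>ln_Gamma\<close> is a holomorphic logarithm of \<open>Gamma\<close> whose
  derivative, the Digamma function, has positive imaginary part; hence \<open>ln_Gamma\<close> is injective on the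
  convex set \<open>H\<close>. It tends to infinity at infinity and at the poles, and at every other real point \<open>x\<close> it
  has the boundary value \<open>ln \<bar>Gamma x\<bar> + i pi min 0 \<lfloor>x\<rfloor>\<close> (the argument drops by \<open>pi\<close> at each pole), which
  injectivity keeps out of the image. So the image of \<open>H\<close> is open and its boundary consists of these values:
  it is the plane without the half-lines \<open>[m j, \<infinity>) - i pi j\<close> for \<open>j = 0, 1, 2, \<dots>\<close>, where \<open>m j\<close> is the
  minimum of \<open>ln \<bar>Gamma\<bar>\<close> on the \<open>j\<close>-th real interval between poles. The domains are the preimages of the strips
  \<open>(2k - 1) pi < Im l < (2k + 1) pi\<close> under \<open>ln_Gamma\<close> and their complex conjugates. On such a (slit) strip \<open>exp\<close> is
  injective, with image the plane without the negative real axis (and without \<open>[exp (m j), \<infinity>)\<close> for \<open>j = - 2k\<close> if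
  \<open>k \<le> 0\<close>); the complement in the sphere is an arc through infinity.\<close>

subsection \<open>Imaginary part of the Digamma function and injectivity of \<open>ln_Gamma\<close>\<close>

abbreviation upper_half_plane :: "complex set" where
  "upper_half_plane \<equiv> {z. 0 < Im z}"

lemma upper_half_plane_notin_nonpos_Reals: "0 < Im z \<Longrightarrow> z \<notin> \<real>\<^sub>\<le>\<^sub>0"
  by (auto simp: complex_nonpos_Reals_iff)

lemma upper_half_plane_notin_nonpos_Ints: "0 < Im z \<Longrightarrow> z \<notin> \<int>\<^sub>\<le>\<^sub>0"
  by (auto elim!: nonpos_Ints_cases)

lemma Digamma_sums:
  fixes z :: complex
  assumes "z \<noteq> 0"
  shows "(\<lambda>n. inverse (of_nat (Suc n)) - inverse (z + of_nat n)) sums (Digamma z + euler_mascheroni)"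
  using summable_Digamma[OF assms] by (simp add: Digamma_def summable_sums)

lemma euler_mascheroni_complex [simp]:
  "Im (euler_mascheroni :: complex) = 0" "cnj euler_mascheroni = euler_mascheroni"
  by (metis Im_complex_of_real of_real_euler_mascheroni, metis complex_cnj_complex_of_real of_real_euler_mascheroni)

lemma Im_inverse_shift:
  "Im (inverse (of_nat (Suc n)) - inverse (z + of_nat n)) = Im z / ((Re z + real n)\<^sup>2 + (Im z)\<^sup>2)"
proof -
  have "Im (inverse (complex_of_nat (Suc n))) = 0"
    by (metis Im_complex_of_real of_real_inverse of_real_of_nat_eq)
  then show ?thesis by (simp del: of_nat_Suc)
qed

text \<open>All terms of the series for \<open>Im (Digamma z)\<close> are positive in the upper half
  plane, so every finite partial sum is a lower bound. The index set stays free so that it can be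
  placed where the terms are large.\<close>

lemma Im_Digamma_ge_sum:
  assumes "0 < Im z" "finite I"
  shows "(\<Sum>n\<in>I. Im z / ((Re z + real n)\<^sup>2 + (Im z)\<^sup>2)) \<le> Im (Digamma z)"
proof -
  have "z \<noteq> 0" using assms by auto
  from sums_Im[OF Digamma_sums[OF this]]
  have s: "(\<lambda>n. Im z / ((Re z + real n)\<^sup>2 + (Im z)\<^sup>2)) sums Im (Digamma z)"
    unfolding Im_inverse_shift by simp
  show ?thesis
    using sum_le_suminf[OF sums_summable[OF s] assms(2)] assms(1) s by (simp add: sums_iff)
qed

lemma Im_Digamma_pos:
  assumes "0 < Im z"
  shows "0 < Im (Digamma z)"
proof -
  have "0 < Im z / ((Re z)\<^sup>2 + (Im z)\<^sup>2)"
    using assms by (intro divide_pos_pos add_nonneg_pos) auto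
  also have "\<dots> \<le> Im (Digamma z)"
    using Im_Digamma_ge_sum[OF assms, of "{0}"] by simp
  finally show ?thesis .
qed

section \<open>Quantitative lower bounds for the imaginary part of \<open>Digamma\<close>\<close>

lemma nat_floor_bounds:
  fixes t :: real
  assumes "1 \<le> t"
  shows "real (nat \<lfloor>t\<rfloor>) \<le> t" "t / 2 \<le> real (nat \<lfloor>t\<rfloor>)"
proof -
  have "1 \<le> \<lfloor>t\<rfloor>" using assms by linarith
  moreover from this have "real (nat \<lfloor>t\<rfloor>) = real_of_int \<lfloor>t\<rfloor>" by simp
  ultimately show "real (nat \<lfloor>t\<rfloor>) \<le> t" "t / 2 \<le> real (nat \<lfloor>t\<rfloor>)" by linarith+
qed

text \<open>With \<open>x = Re z\<close> and \<open>y = Im z\<close>, each of the first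
  \<open>\<lfloor>x + y\<rfloor>\<close> terms has denominator at most
  \<open>5 * (x + y)\<^sup>2\<close>, and there are at least \<open>(x + y) / 2\<close> of
  them.\<close>

lemma Im_Digamma_ge_right:
  assumes "0 \<le> Re z" "1 \<le> Im z"
  shows "Im z / (10 * (Re z + Im z)) \<le> Im (Digamma z)"
proof -
  define x y where "x = Re z" and "y = Im z"
  define N where "N = nat \<lfloor>x + y\<rfloor>"
  have xy: "x \<ge> 0" "y \<ge> 1" using assms by (auto simp: x_def y_def)
  have N: "real N \<le> x + y" "(x + y) / 2 \<le> real N"
    using nat_floor_bounds[of "x + y"] xy unfolding N_def by auto
  have trm: "y / (5 * (x + y)\<^sup>2) \<le> y / ((x + real n)\<^sup>2 + y\<^sup>2)" if "n < N" for n
  proof -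
    have "(x + real n)\<^sup>2 \<le> (2 * (x + y))\<^sup>2"
      using N that xy by (intro power_mono) auto
    moreover have "y\<^sup>2 \<le> (x + y)\<^sup>2" using xy by (intro power_mono) auto
    moreover have "0 < (x + real n)\<^sup>2 + y\<^sup>2" using xy by (intro add_nonneg_pos) auto
    moreover have "(2 * (x + y))\<^sup>2 = 4 * (x + y)\<^sup>2" by (simp only: power_mult_distrib) simp
    ultimately have "(x + real n)\<^sup>2 + y\<^sup>2 \<le> 5 * (x + y)\<^sup>2" "0 < (x + real n)\<^sup>2 + y\<^sup>2"
      by linarith+
    then show ?thesis
      using xy by (intro divide_left_mono mult_pos_pos) auto
  qed
  have "y / (10 * (x + y)) = ((x + y) / 2) * (y / (5 * (x + y)\<^sup>2))"
    using xy by (simp add: power2_eq_square)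
  also have "\<dots> \<le> real N * (y / (5 * (x + y)\<^sup>2))"
    using N xy by (intro mult_right_mono) auto
  also have "\<dots> \<le> (\<Sum>n<N. y / ((x + real n)\<^sup>2 + y\<^sup>2))"
    using sum_mono[of "{..<N}" "\<lambda>_. y / (5 * (x + y)\<^sup>2)"] trm by auto
  also have "\<dots> \<le> Im (Digamma z)"
    using Im_Digamma_ge_sum[of z "{..<N}"] xy by (simp add: x_def y_def)
  finally show ?thesis by (simp add: x_def y_def)
qed

text \<open>Here the large terms are not the first ones but those with
  \<open>0 \<le> Re z + n \<le> Im z\<close>: each is at least \<open>1 / (2 * Im z)\<close>, and at
  least \<open>Im z / 2\<close> such indices are available.\<close>

lemma Im_Digamma_ge_left:
  assumes "Re z \<le> 0" "1 \<le> Im z"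
  shows "1 / 4 \<le> Im (Digamma z)"
proof -
  define x y where "x = Re z" and "y = Im z"
  define N where "N = nat \<lfloor>y\<rfloor>"
  define a where "a = nat \<lceil>- x\<rceil>"
  have xy: "x \<le> 0" "y \<ge> 1" using assms by (auto simp: x_def y_def)
  have N: "real N \<le> y" "y / 2 \<le> real N"
    using nat_floor_bounds[of "y"] xy unfolding N_def by auto
  have a: "- x \<le> real a" "real a \<le> 1 - x"
    using xy unfolding a_def by linarith+
  have trm: "1 / (2 * y) \<le> y / ((x + real n)\<^sup>2 + y\<^sup>2)" if "n \<in> {a..<a + N}" for n
  proof -
    have "real n + 1 \<le> real a + real N" using that by auto
    then have "0 \<le> x + real n" "x + real n \<le> y"
      using a N that by auto
    then have "(x + real n)\<^sup>2 + y\<^sup>2 \<le> 2 * y\<^sup>2" using power_mono[of "x + real n" y 2] by simp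
    moreover have "0 < (x + real n)\<^sup>2 + y\<^sup>2" using xy by (intro add_nonneg_pos) auto
    ultimately have "y / (2 * y\<^sup>2) \<le> y / ((x + real n)\<^sup>2 + y\<^sup>2)"
      using xy by (intro divide_left_mono) auto
    then show ?thesis using xy by (simp add: power2_eq_square)
  qed
  have "1 / 4 = (y / 2) * (1 / (2 * y))" using xy by simp
  also have "\<dots> \<le> real N * (1 / (2 * y))" using N xy by (intro mult_right_mono) auto
  also have "\<dots> \<le> (\<Sum>n\<in>{a..<a + N}. y / ((x + real n)\<^sup>2 + y\<^sup>2))"
    using sum_mono[of "{a..<a + N}" "\<lambda>_. 1 / (2 * y)"] trm by auto
  also have "\<dots> \<le> Im (Digamma z)"
    using Im_Digamma_ge_sum[of z "{a..<a + N}"] xy by (simp add: x_def y_def)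
  finally show ?thesis .
qed

lemma Digamma_cnj:
  assumes "z \<noteq> 0"
  shows "Digamma (cnj z) = cnj (Digamma z)"
proof -
  from Digamma_sums[OF assms]
  have "(\<lambda>n. cnj (inverse (of_nat (Suc n)) - inverse (z + of_nat n))) sums cnj (Digamma z + euler_mascheroni)"
    by (simp only: sums_cnj)
  then have "(\<lambda>n. inverse (of_nat (Suc n)) - inverse (cnj z + of_nat n)) sums (cnj (Digamma z) + euler_mascheroni)"
    by simp
  from sums_unique2[OF this Digamma_sums] assms show ?thesis by auto
qed

text \<open>Conjugation carries the positivity of the imaginary part over to the lower half plane.
  The result makes the derivative \<open>Gamma z * Digamma z\<close> nonzero there as well.\<close>

lemma Digamma_nonzero:
  assumes "Im z \<noteq> 0"
  shows "Digamma z \<noteq> 0"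
  using Im_Digamma_pos[of z] Im_Digamma_pos[of "cnj z"] Digamma_cnj[of z] assms
  by (cases "Im z > 0"; cases "z = 0") auto

text \<open>The mean value theorem on a segment controls a real part. Applied to
  \<open>- \<i> * f u / (b - a)\<close> it yields the imaginary part of the difference
  quotient.\<close>

lemma complex_mvt_Im:
  assumes "\<And>u. u \<in> closed_segment a b \<Longrightarrow> (f has_field_derivative f' u) (at u)" "a \<noteq> b"
  shows "\<exists>u\<in>closed_segment a b. Im ((f b - f a) / (b - a)) = Im (f' u)"
proof -
  have "((\<lambda>u. - \<i> * f u / (b - a)) has_field_derivative - \<i> * f' u / (b - a)) (at u)"
    if "u \<in> closed_segment a b" for u
    using assms(1)[OF that] assms(2) by (auto intro!: derivative_eq_intros)
  from complex_mvt_line[of a b, OF this] obtain u where u: "u \<in> closed_segment a b"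
    "Re (- \<i> * f b / (b - a)) - Re (- \<i> * f a / (b - a)) = Re (- \<i> * f' u / (b - a) * (b - a))"
    by blast
  have "- \<i> * f' u / (b - a) * (b - a) = - \<i> * f' u" using assms(2) by simp
  moreover have "Re (- \<i> * f b / (b - a)) - Re (- \<i> * f a / (b - a)) = Re (- \<i> * ((f b - f a) / (b - a)))"
    by (simp add: right_diff_distrib diff_divide_distrib flip: minus_complex.simps)
  moreover have "Re (- \<i> * w) = Im w" for w by simp
  ultimately show ?thesis using u by metis
qed

lemma ln_Gamma_difference_quotient:
  assumes "0 < Im a" "0 < Im b" "a \<noteq> b"
  shows "\<exists>u\<in>closed_segment a b. Im ((ln_Gamma b - ln_Gamma a) / (b - a)) = Im (Digamma u)"
proof (rule complex_mvt_Im)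
  fix u assume "u \<in> closed_segment a b"
  moreover have "closed_segment a b \<subseteq> upper_half_plane"
    using assms by (intro closed_segment_subset convex_halfspace_Im_gt) auto
  ultimately show "(ln_Gamma has_field_derivative Digamma u) (at u)"
    by (intro has_field_derivative_ln_Gamma_complex upper_half_plane_notin_nonpos_Reals) auto
qed (use assms in auto)

text \<open>The Noshiro-Warschawski argument: on a convex set, a derivative with positive imaginary
  part excludes a vanishing difference quotient.\<close>

lemma inj_on_ln_Gamma: "inj_on ln_Gamma upper_half_plane"
proof (rule inj_onI, rule ccontr)
  fix a b :: complex
  assume ab: "a \<in> upper_half_plane" "b \<in> upper_half_plane" "ln_Gamma a = ln_Gamma b" "a \<noteq> b"
  then obtain u where u: "u \<in> closed_segment a b" "Im ((ln_Gamma b - ln_Gamma a) / (b - a)) = Im (Digamma u)"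
    using ln_Gamma_difference_quotient[of a b] by auto
  have "closed_segment a b \<subseteq> upper_half_plane"
    using ab by (intro closed_segment_subset convex_halfspace_Im_gt) auto
  with u Im_Digamma_pos[of u] ab show False by auto
qed

text \<open>The difference quotient between \<open>\<i>\<close> and \<open>z\<close> is bounded
  below by \<open>Im (Digamma u)\<close> at some \<open>u\<close> of the segment. The base point
  \<open>\<i>\<close> keeps the segment in the region \<open>1 \<le> Im u\<close>, where the
  quantitative bounds hold; far to the right they are weak, but the length of the segment
  compensates.\<close>

lemma ln_Gamma_Im_lower_bound:
  assumes "2 \<le> Im z"
  shows "Im z / 40 \<le> norm (ln_Gamma z - ln_Gamma \<i>)"
proof -
  define x y where "x = Re z" and "y = Im z"
  have y: "y \<ge> 2" using assms by (simp add: y_def)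
  have zi: "z \<noteq> \<i>" using assms by auto
  obtain u where u: "u \<in> closed_segment \<i> z"
    "Im ((ln_Gamma z - ln_Gamma \<i>) / (z - \<i>)) = Im (Digamma u)"
    using ln_Gamma_difference_quotient[of \<i> z] zi assms by auto
  from u(1) obtain s where s: "0 \<le> s" "s \<le> 1" "u = (1 - s) *\<^sub>R \<i> + s *\<^sub>R z"
    unfolding closed_segment_def by blast
  have Reu: "Re u = s * x" and Imu: "Im u = 1 + s * (y - 1)"
    unfolding s(3) by (auto simp: x_def y_def algebra_simps)
  have Imu1: "1 \<le> Im u" unfolding Imu using s y by simp
  have nz: "\<bar>x\<bar> \<le> norm (z - \<i>)" "y - 1 \<le> norm (z - \<i>)"
    using abs_Re_le_cmod[of "z - \<i>"] abs_Im_le_cmod[of "z - \<i>"] by (auto simp: x_def y_def)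
  have main: "y / 40 \<le> Im (Digamma u) * norm (z - \<i>)"
  proof (cases "x \<ge> 0")
    case True
    \<comment> \<open>On the segment the ratio \<open>Im u / (Re u + Im u)\<close> starts at 1 for
      \<open>\<i>\<close> and is smallest at the end \<open>z\<close>.\<close>
    have "y * (Re u + Im u) \<le> Im u * (x + y)"
    proof -
      have "0 \<le> x * (1 - s)" using True s by simp
      then show ?thesis unfolding Reu Imu by (simp add: algebra_simps)
    qed
    moreover have "0 < Re u + Im u" "0 < x + y" using True s Imu1 Reu y by (auto intro: add_nonneg_pos)
    ultimately have "y / (10 * (x + y)) \<le> Im u / (10 * (Re u + Im u))"
      by (subst pos_divide_le_eq) (simp_all add: pos_le_divide_eq algebra_simps)
    also have "\<dots> \<le> Im (Digamma u)"
      using Im_Digamma_ge_right[of u] True s Reu Imu1 by auto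
    finally have 1: "y / (10 * (x + y)) \<le> Im (Digamma u)" .
    have "x \<le> norm (z - \<i>)" using nz True by simp
    with nz y have 2: "(x + y) / 4 \<le> norm (z - \<i>)" by argo
    have "y / 40 = (y / (10 * t)) * (t / 4)" if "t \<noteq> 0" for t using that by simp
    from this[of "x + y"] have "y / 40 = (y / (10 * (x + y))) * ((x + y) / 4)" using True y by auto
    also have "\<dots> \<le> Im (Digamma u) * norm (z - \<i>)"
      using True y by (intro mult_mono 1 2 order.trans[OF _ 1]) auto
    finally show ?thesis .
  next
    case False
    then have "1 / 4 \<le> Im (Digamma u)"
      using s Reu Imu1 by (intro Im_Digamma_ge_left) (auto simp: mult_le_0_iff)
    then have "(1 / 4) * (y - 1) \<le> Im (Digamma u) * norm (z - \<i>)"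
      using nz y by (intro mult_mono) auto
    then show ?thesis using y by simp
  qed
  also have "Im (Digamma u) * norm (z - \<i>) \<le> norm ((ln_Gamma z - ln_Gamma \<i>) / (z - \<i>)) * norm (z - \<i>)"
    unfolding u(2)[symmetric] by (intro mult_right_mono order.trans[OF abs_ge_self abs_Im_le_cmod]) auto
  also have "\<dots> = norm (ln_Gamma z - ln_Gamma \<i>)"
    using zi by (simp add: norm_divide)
  finally show ?thesis by (simp add: y_def)
qed

subsection \<open>Growth and boundary behaviour of \<open>ln_Gamma\<close>\<close>

text \<open>The difference of both sides has derivative 0 on the plane slit along the nonpositive
  axis, which is connected, and it vanishes at 1; so no multiple of \<open>2 pi \<i>\<close>
  appears.\<close>

lemma ln_Gamma_plus1:
  fixes z :: complex
  assumes "z \<notin> \<real>\<^sub>\<le>\<^sub>0"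
  shows "ln_Gamma (z + 1) = ln_Gamma z + Ln z"
proof -
  define S where "S = - (\<real>\<^sub>\<le>\<^sub>0 :: complex set)"
  define f :: "complex \<Rightarrow> complex" where "f = (\<lambda>z. ln_Gamma (z + 1) - ln_Gamma z - Ln z)"
  have S1: "u + 1 \<notin> \<real>\<^sub>\<le>\<^sub>0" "u \<noteq> 0" if "u \<in> S" for u
    using that by (auto simp: S_def complex_nonpos_Reals_iff)
  have deriv: "(f has_field_derivative 0) (at u)" if "u \<in> S" for u
    unfolding f_def using that S1[OF that] Digamma_plus1[of u]
    by (auto intro!: derivative_eq_intros simp: S_def field_simps)
  have "S = - (complex_of_real ` {..0})"
    by (auto simp: S_def nonpos_Reals_def)
  then have "connected S"
    by (simp add: starlike_imp_connected starlike_slotted_complex_plane_left)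
  moreover have "open S" by (simp add: S_def open_Compl)
  moreover have "continuous_on S f"
    using deriv by (meson DERIV_continuous_on has_field_derivative_at_within)
  ultimately obtain c where c: "\<And>u. u \<in> S \<Longrightarrow> f u = c"
    using DERIV_zero_connected_constant[of S "{}" f] deriv by auto
  have "f 1 = 0"
    using ln_Gamma_complex_conv_fact[of 1] ln_Gamma_complex_conv_fact[of 2] by (simp add: f_def)
  moreover have "1 \<in> S" by (simp add: S_def)
  ultimately have "f z = 0" using c[of 1] c[of z] assms by (simp add: S_def)
  then show ?thesis by (simp add: f_def algebra_simps)
qed

section \<open>Iterated functional equation and properness of \<open>ln_Gamma\<close>\<close>

lemma ln_Gamma_plus_of_nat:
  assumes "0 < Im z"
  shows "ln_Gamma (z + of_nat n) = ln_Gamma z + (\<Sum>j<n. Ln (z + of_nat j))"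
proof (induction n)
  case (Suc n)
  have "ln_Gamma ((z + of_nat n) + 1) = ln_Gamma (z + of_nat n) + Ln (z + of_nat n)"
    using assms by (intro ln_Gamma_plus1 upper_half_plane_notin_nonpos_Reals) simp
  then show ?case using Suc by (simp add: algebra_simps)
qed simp

text \<open>From \<open>j = 2\<close> on, \<open>z + j\<close> has modulus at least
  \<open>1 + j \<ge> exp 1\<close> and contributes at least 1; the first two terms are merely
  nonnegative, whence the loss of 2.\<close>

lemma Re_Ln_sum_lower_bound:
  assumes "0 < Im z" "1 \<le> Re z"
  shows "real n - 2 \<le> Re (\<Sum>j<n. Ln (z + of_nat j))"
proof (induction n)
  case (Suc n)
  have n0: "z + of_nat n \<noteq> 0" using assms by (auto simp: complex_eq_iff)
  have "1 + real n \<le> norm (z + of_nat n)"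
    using complex_Re_le_cmod[of "z + of_nat n"] assms by simp
  then have "ln (1 + real n) \<le> Re (Ln (z + of_nat n))"
    using n0 by simp
  moreover have "1 \<le> ln (1 + real n)" if "n \<ge> 2"
  proof -
    have "exp 1 \<le> 1 + real n" using exp_le that by linarith
    then show ?thesis by (subst ln_ge_iff) auto
  qed
  moreover have "0 \<le> ln (1 + real n)" by simp
  moreover have "0 \<le> Re (\<Sum>j<n. Ln (z + of_nat j))"
  proof -
    have "0 \<le> Re (Ln (z + of_nat j))" for j
    proof -
      have "1 \<le> norm (z + of_nat j)" using complex_Re_le_cmod[of "z + of_nat j"] assms by simp
      moreover have "z + of_nat j \<noteq> 0" using assms by (auto simp: complex_eq_iff)
      ultimately show ?thesis by simp
    qed
    then show ?thesis by (simp add: sum_nonneg)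
  qed
  moreover have "0 \<le> Re (Ln (z + of_nat n))" using calculation(1,3) by linarith
  ultimately show ?case using Suc by (cases "n \<ge> 2") (auto simp del: Re_Ln Re_sum)
qed simp

text \<open>For \<open>j + 2 \<le> n\<close> the point \<open>z + j\<close> is not in the right half
  plane, so its argument is at least \<open>pi / 2 \<ge> 1\<close>; the remaining arguments are
  nonnegative.\<close>

lemma Im_Ln_sum_lower_bound:
  assumes "0 < Im z" "Re z \<le> 2 - real n"
  shows "real n - 2 \<le> Im (\<Sum>j<n. Ln (z + of_nat j))"
proof -
  have pos: "0 \<le> Im (Ln (z + of_nat j))" for j
    using Im_Ln_pos_lt[of "z + of_nat j"] assms by (auto simp: complex_eq_iff)
  have big: "1 \<le> Im (Ln (z + of_nat j))" if "j + 2 \<le> n" for j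
  proof -
    have "\<not> \<bar>Im (Ln (z + of_nat j))\<bar> < pi / 2"
      using assms that by (subst Re_Ln_pos_lt) (auto simp: complex_eq_iff)
    then show ?thesis using pos[of j] pi_ge_two by linarith
  qed
  have "real n - 2 \<le> (\<Sum>j<n - 2. 1)" by simp
  also have "\<dots> \<le> (\<Sum>j<n - 2. Im (Ln (z + of_nat j)))"
    by (intro sum_mono big) auto
  also have "\<dots> \<le> (\<Sum>j<n. Im (Ln (z + of_nat j)))"
    by (intro sum_mono2 pos) auto
  finally show ?thesis by simp
qed

text \<open>\<open>ln_Gamma\<close> is proper in the sense that it tends to infinity at infinity within the upper half
  plane: for large imaginary part this follows from the lower bound on its difference quotients, and
  in a horizontal strip from the functional equation.\<close>

lemma ln_Gamma_bounded_imp_bounded: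
  "\<exists>R. \<forall>z. 0 < Im z \<longrightarrow> norm (ln_Gamma z) \<le> M \<longrightarrow> norm z \<le> R"
proof -
  \<comment> \<open>\<open>Y\<close> bounds \<open>Im z\<close>, because
    \<open>ln_Gamma_Im_lower_bound\<close> gives
    \<open>Im z / 40 \<le> M + norm (ln_Gamma \<i>)\<close> once \<open>Im z \<ge> 2\<close>. The
    points in question are then integer translates of points of the rectangle
    \<open>K\<close>.\<close>
  define Y where "Y = max 2 (40 * (M + norm (ln_Gamma \<i>)))"
  define K where "K = cbox (Complex 1 0) (Complex 2 Y)"
  have "continuous_on K ln_Gamma"
    by (intro continuous_on_ln_Gamma_complex)
       (auto simp: K_def in_cbox_complex_iff complex_nonpos_Reals_iff)
  moreover have "compact K" by (simp add: K_def)
  ultimately have "bounded (ln_Gamma ` K)"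
    using compact_continuous_image compact_imp_bounded by blast
  then obtain C where C: "\<And>w. w \<in> K \<Longrightarrow> norm (ln_Gamma w) \<le> C"
    by (auto simp: bounded_iff)
  have "norm z \<le> 2 + Y + (M + C + 2)" if z: "0 < Im z" "norm (ln_Gamma z) \<le> M" for z
  proof -
    have Y: "Im z \<le> Y"
    proof (cases "Im z \<ge> 2")
      case True
      from ln_Gamma_Im_lower_bound[OF this] show ?thesis
        using norm_triangle_ineq4[of "ln_Gamma z" "ln_Gamma \<i>"] z(2) by (simp add: Y_def)
    qed (auto simp: Y_def)
    define m where "m = \<lfloor>Re z\<rfloor> - 1"
    define w where "w = z - of_int m"
    have Rew: "1 \<le> Re w" "Re w < 2" unfolding w_def m_def by simp_all linarith
    have Imw: "Im w = Im z" by (simp add: w_def)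
    have "w \<in> K" using Rew Imw z Y by (simp add: K_def in_cbox_complex_iff)
    from C[OF this] have Cw: "norm (ln_Gamma w) \<le> C" .
    \<comment> \<open>A translation to the right by \<open>m\<close> raises the real part of
      \<open>ln_Gamma\<close> by at least \<open>m - 2\<close>; a translation to the left by
      \<open>- m\<close> lowers the imaginary part by at least \<open>- m - 2\<close>.\<close>
    have "real_of_int \<bar>m\<bar> \<le> M + C + 2"
    proof (cases "m \<ge> 0")
      case True
      then have zw: "z = w + of_nat (nat m)" by (simp add: w_def)
      have "ln_Gamma z = ln_Gamma w + (\<Sum>j<nat m. Ln (w + of_nat j))"
        using ln_Gamma_plus_of_nat[of w "nat m"] z(1) Imw unfolding zw[symmetric] by simp
      then have "Re (ln_Gamma z) = Re (ln_Gamma w) + Re (\<Sum>j<nat m. Ln (w + of_nat j))"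
        by (simp only: plus_complex.simps)
      moreover have "real (nat m) - 2 \<le> Re (\<Sum>j<nat m. Ln (w + of_nat j))"
        using Re_Ln_sum_lower_bound[of w "nat m"] Rew Imw z by simp
      moreover have "\<bar>Re (ln_Gamma z)\<bar> \<le> M" "\<bar>Re (ln_Gamma w)\<bar> \<le> C"
        using abs_Re_le_cmod z Cw by (meson order.trans)+
      moreover have "real (nat m) = real_of_int \<bar>m\<bar>" using True by simp
      ultimately show ?thesis by linarith
    next
      case False
      then have wz: "w = z + of_nat (nat (- m))" by (simp add: w_def)
      have "ln_Gamma w = ln_Gamma z + (\<Sum>j<nat (- m). Ln (z + of_nat j))"
        using ln_Gamma_plus_of_nat[of z "nat (- m)"] z(1) unfolding wz[symmetric] by simp
      then have "Im (ln_Gamma w) = Im (ln_Gamma z) + Im (\<Sum>j<nat (- m). Ln (z + of_nat j))"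
        by (simp only: plus_complex.simps)
      moreover have "real (nat (- m)) - 2 \<le> Im (\<Sum>j<nat (- m). Ln (z + of_nat j))"
      proof (rule Im_Ln_sum_lower_bound)
        show "Re z \<le> 2 - real (nat (- m))" using False Rew by (simp add: w_def)
      qed (use z in auto)
      moreover have "\<bar>Im (ln_Gamma z)\<bar> \<le> M" "\<bar>Im (ln_Gamma w)\<bar> \<le> C"
        using abs_Im_le_cmod z Cw by (meson order.trans)+
      moreover have "real (nat (- m)) = real_of_int \<bar>m\<bar>" using False by simp
      ultimately show ?thesis by linarith
    qed
    moreover have "norm w \<le> 2 + Y"
      using cmod_le[of w] Rew Imw z Y by simp
    moreover have "norm z \<le> norm w + real_of_int \<bar>m\<bar>"
      using norm_triangle_ineq[of w "of_int m"] by (simp add: w_def)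
    ultimately show ?thesis by linarith
  qed
  then show ?thesis by blast
qed

text \<open>Taking \<open>-\<i> w\<close> as argument moves the branch cut of the logarithm to the lower half plane, so the
  right-hand side is continuous up to the real axis.\<close>

lemma Ln_upper_half_plane_closure:
  assumes "0 \<le> Im w" "w \<noteq> 0"
  shows "Ln w = Ln (- \<i> * w) + \<i> * pi / 2"
  using Ln_times_ii[of "- \<i> * w"] assms by simp

text \<open>The functional equation solved for \<open>ln_Gamma z\<close>, with every logarithm in
  its rotated form. It equals \<open>ln_Gamma\<close> on the upper half plane and is continuous at
  the real points right of \<open>- N\<close> other than poles, also where \<open>ln_Gamma\<close>
  has its cut.\<close>

definition ln_Gamma_ext :: "nat \<Rightarrow> complex \<Rightarrow> complex" where
  "ln_Gamma_ext N z = ln_Gamma (z + of_nat N) - (\<Sum>j<N. Ln (- \<i> * (z + of_nat j)) + \<i> * pi / 2)"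

lemma ln_Gamma_ext_eq:
  assumes "0 < Im z"
  shows "ln_Gamma_ext N z = ln_Gamma z"
proof -
  have "Ln (- \<i> * (z + of_nat j)) + \<i> * pi / 2 = Ln (z + of_nat j)" for j
    using assms by (intro Ln_upper_half_plane_closure[symmetric]) (auto simp: complex_eq_iff)
  then show ?thesis
    unfolding ln_Gamma_ext_def ln_Gamma_plus_of_nat[OF assms] by (simp only: add_diff_cancel_right')
qed

lemma isCont_ln_Gamma_ext:
  fixes x :: real
  assumes "x \<notin> \<int>\<^sub>\<le>\<^sub>0" "- real N < x"
  shows "isCont (ln_Gamma_ext N) (of_real x)"
proof -
  have "- \<i> * (of_real x + of_nat j) \<notin> \<real>\<^sub>\<le>\<^sub>0" for j
  proof -
    have "x \<noteq> - real j" using assms(1) by auto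
    then have "x + real j \<noteq> 0" by linarith
    then show ?thesis by (auto simp: complex_nonpos_Reals_iff)
  qed
  moreover have "of_real x + of_nat N \<notin> (\<real>\<^sub>\<le>\<^sub>0 :: complex set)"
    using assms(2) by (auto simp: complex_nonpos_Reals_iff)
  ultimately show ?thesis unfolding ln_Gamma_ext_def
    by (intro continuous_intros isCont_Ln') auto
qed

section \<open>Limits at real points from the upper half plane\<close>

lemma at_within_upper_half_plane_nontrivial:
  "at (of_real x) within upper_half_plane \<noteq> bot"
proof -
  have "of_real x islimpt upper_half_plane"
    unfolding islimpt_approachable
  proof (intro allI impI)
    fix e :: real assume "e > 0"
    then show "\<exists>x'\<in>upper_half_plane. x' \<noteq> of_real x \<and> dist x' (of_real x) < e"
      by (intro bexI[of _ "Complex x (e / 2)"]) (auto simp: dist_norm complex_eq_iff cmod_def)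
  qed
  then show ?thesis by (simp add: trivial_limit_within)
qed

definition ln_Gamma_boundary :: "real \<Rightarrow> complex" where
  "ln_Gamma_boundary x = Complex (ln \<bar>Gamma x\<bar>) (pi * of_int (min 0 \<lfloor>x\<rfloor>))"

lemma exp_minus_ln_Gamma: "0 < Im z \<Longrightarrow> exp (- ln_Gamma z) = rGamma z"
  using rGamma_complex_altdef[of z] upper_half_plane_notin_nonpos_Ints[of z] by simp

text \<open>The limit exists by continuity of \<open>ln_Gamma_ext\<close>. Its real part follows
  from \<open>exp (- ln_Gamma z) = rGamma z\<close>, its imaginary part by counting the negative
  factors \<open>x + j\<close>, each of which has argument \<open>pi\<close>.\<close>

lemma tendsto_ln_Gamma_boundary:
  fixes x :: real
  assumes "x \<notin> \<int>\<^sub>\<le>\<^sub>0"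
  shows "(ln_Gamma \<longlongrightarrow> ln_Gamma_boundary x) (at (of_real x) within upper_half_plane)"
proof -
  \<comment> \<open>\<open>N\<close> is the number of poles to the right of \<open>x\<close>, and
    the least shift that makes \<open>x + N\<close> positive.\<close>
  define N where "N = nat (- \<lfloor>x\<rfloor>)"
  define b where "b = ln_Gamma_ext N (of_real x)"
  have xi: "real_of_int \<lfloor>x\<rfloor> \<noteq> x" if "x < 0"
  proof
    assume "real_of_int \<lfloor>x\<rfloor> = x"
    moreover have "real_of_int \<lfloor>x\<rfloor> \<in> \<int>\<^sub>\<le>\<^sub>0" using that by (intro nonpos_Ints_of_int) linarith
    ultimately show False using assms by (simp only:)
  qed
  have x0: "x \<noteq> 0" using assms by auto
  have xN: "- real N < x"
  proof (cases "x > 0")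
    case False
    then have "real N = - real_of_int \<lfloor>x\<rfloor>" using x0 by (simp add: N_def)
    then show ?thesis using xi False x0 by linarith
  qed (simp add: N_def)
  have "(ln_Gamma_ext N \<longlongrightarrow> b) (at (of_real x) within upper_half_plane)"
    using isCont_ln_Gamma_ext[OF assms xN] unfolding b_def isCont_def
    by (rule Lim_at_imp_Lim_at_within)
  moreover have "\<forall>\<^sub>F z in at (of_real x) within upper_half_plane. ln_Gamma_ext N z = ln_Gamma z"
    by (auto simp: eventually_at_filter ln_Gamma_ext_eq)
  ultimately have lim: "(ln_Gamma \<longlongrightarrow> b) (at (of_real x) within upper_half_plane)"
    by (rule Lim_transform_eventually)
  then have "((\<lambda>z. exp (- ln_Gamma z)) \<longlongrightarrow> exp (- b)) (at (of_real x) within upper_half_plane)"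
    by (intro tendsto_intros)
  moreover have "\<forall>\<^sub>F z in at (of_real x) within upper_half_plane. exp (- ln_Gamma z) = rGamma z"
    by (auto simp: eventually_at_filter exp_minus_ln_Gamma)
  ultimately have "(rGamma \<longlongrightarrow> exp (- b)) (at (of_real x) within upper_half_plane)"
    by (rule Lim_transform_eventually)
  moreover have "(rGamma \<longlongrightarrow> rGamma (of_real x :: complex)) (at (of_real x) within upper_half_plane)"
    using isCont_rGamma[OF continuous_ident] unfolding isCont_def by (rule Lim_at_imp_Lim_at_within)
  ultimately have "exp (- b) = rGamma (of_real x)"
    using tendsto_unique at_within_upper_half_plane_nontrivial by blast
  then have "norm (exp (- b)) = \<bar>rGamma x\<bar>" by (simp add: rGamma_complex_of_real)
  then have "exp (- Re b) = inverse \<bar>Gamma x\<bar>" by (simp add: rGamma_inverse_Gamma)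
  then have "exp (Re b) = \<bar>Gamma x\<bar>" by (simp add: exp_minus)
  then have Reb: "Re b = ln \<bar>Gamma x\<bar>" by (metis ln_exp)
  have "Im b = pi * of_int (min 0 \<lfloor>x\<rfloor>)"
  proof -
    have "Im (Ln (- \<i> * (of_real x + of_nat j)) + \<i> * pi / 2) = pi" if "j < N" for j
    proof -
      have "x + real j < 0" using that unfolding N_def by linarith
      then have "Im (Ln (of_real x + of_nat j)) = pi" "of_real x + of_nat j \<noteq> (0 :: complex)"
        using Im_Ln_eq_pi[of "of_real x + of_nat j"] by (auto simp: complex_eq_iff)
      moreover from this(2)
      have "Ln (of_real x + of_nat j) = Ln (- \<i> * (of_real x + of_nat j)) + \<i> * pi / 2"
        by (intro Ln_upper_half_plane_closure) auto
      ultimately show ?thesis by (simp only:)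
    qed
    then have "Im (\<Sum>j<N. Ln (- \<i> * (of_real x + of_nat j)) + \<i> * pi / 2) = real N * pi"
      by (subst Im_sum) simp
    moreover have "Im (ln_Gamma (of_real x + of_nat N)) = 0"
      using ln_Gamma_complex_of_real[of "x + real N"] xN by simp
    moreover have "real N = - of_int (min 0 \<lfloor>x\<rfloor>)" unfolding N_def by (simp add: min_def)
    ultimately show ?thesis by (simp add: b_def ln_Gamma_ext_def)
  qed
  with Reb have "b = ln_Gamma_boundary x" by (simp add: ln_Gamma_boundary_def complex_eq_iff)
  with lim show ?thesis by simp
qed

text \<open>\<open>ln_Gamma\<close> is unbounded near the poles, but its imaginary part is not: a
  shift by \<open>N\<close> leads into a compact disc off the cut, and the \<open>N\<close>
  logarithms change the imaginary part by at most \<open>N * pi\<close>.\<close>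

lemma Im_ln_Gamma_bounded:
  "\<exists>C. \<forall>z. 0 < Im z \<longrightarrow> norm z \<le> R \<longrightarrow> \<bar>Im (ln_Gamma z)\<bar> \<le> C"
proof -
  define N where "N = nat \<lceil>R\<rceil> + 1"
  have RN: "R < real N" unfolding N_def by linarith
  have "0 < Re w" if "w \<in> cball (of_nat N) R" for w
    using that RN abs_Re_le_cmod[of "of_nat N - w"] by (auto simp: dist_norm)
  then have "continuous_on (cball (of_nat N) R) (ln_Gamma :: complex \<Rightarrow> complex)"
    by (intro continuous_on_ln_Gamma_complex) (fastforce simp: complex_nonpos_Reals_iff)
  then have "bounded (ln_Gamma ` cball (of_nat N :: complex) R)"
    using compact_continuous_image compact_imp_bounded compact_cball by blast
  then obtain C where C: "\<And>w. w \<in> cball (of_nat N :: complex) R \<Longrightarrow> norm (ln_Gamma w) \<le> C"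
    unfolding bounded_iff by blast
  have "\<bar>Im (ln_Gamma z)\<bar> \<le> C + real N * pi" if z: "0 < Im z" "norm z \<le> R" for z
  proof -
    have "norm (ln_Gamma (z + of_nat N)) \<le> C"
      using z by (intro C) (simp add: dist_norm)
    then have "\<bar>Im (ln_Gamma (z + of_nat N))\<bar> \<le> C" using abs_Im_le_cmod order.trans by blast
    moreover have "Im (ln_Gamma (z + of_nat N)) = Im (ln_Gamma z) + (\<Sum>j<N. Im (Ln (z + of_nat j)))"
      using ln_Gamma_plus_of_nat[OF z(1), of N] by simp
    moreover have "\<bar>\<Sum>j<N. Im (Ln (z + of_nat j))\<bar> \<le> real N * pi"
    proof -
      have "\<bar>Im (Ln (z + of_nat j))\<bar> \<le> pi" for j
        using mpi_less_Im_Ln[of "z + of_nat j"] Im_Ln_le_pi[of "z + of_nat j"] z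
        by (auto simp: complex_eq_iff abs_le_iff)
      from sum_mono[of "{..<N}" "\<lambda>j. \<bar>Im (Ln (z + of_nat j))\<bar>" "\<lambda>_. pi", OF this]
      have "(\<Sum>j<N. \<bar>Im (Ln (z + of_nat j))\<bar>) \<le> real N * pi" by simp
      then show ?thesis by (rule order.trans[OF sum_abs])
    qed
    ultimately show ?thesis by linarith
  qed
  then show ?thesis by blast
qed

text \<open>A shift by \<open>Suc n\<close> moves the pole \<open>- n\<close> to 1, where
  \<open>ln_Gamma\<close> vanishes, and it can only increase the imaginary part because the added
  arguments are nonnegative.\<close>

lemma Im_ln_Gamma_near_pole:
  assumes p: "p \<in> \<int>\<^sub>\<le>\<^sub>0" and "0 < e"
  shows "\<forall>\<^sub>F z in at p within upper_half_plane. Im (ln_Gamma z) < e"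
proof -
  obtain n where n: "p = - of_nat n" using p by (elim nonpos_Ints_cases')
  have "isCont (\<lambda>z. ln_Gamma (z + of_nat (Suc n))) p"
    by (intro isCont_ln_Gamma_complex continuous_intros) (simp add: n complex_nonpos_Reals_iff)
  then have "isCont (\<lambda>z. Im (ln_Gamma (z + of_nat (Suc n)))) p"
    unfolding isCont_def by (rule tendsto_Im)
  then have "((\<lambda>z. Im (ln_Gamma (z + of_nat (Suc n)))) \<longlongrightarrow> Im (ln_Gamma (p + of_nat (Suc n))))
      (at p within upper_half_plane)"
    unfolding isCont_def by (rule Lim_at_imp_Lim_at_within)
  moreover have "Im (ln_Gamma (p + of_nat (Suc n))) = 0"
    using ln_Gamma_complex_conv_fact[of 1] by (simp add: n)
  ultimately have ev: "\<forall>\<^sub>F z in at p within upper_half_plane. Im (ln_Gamma (z + of_nat (Suc n))) < e"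
    using assms(2) by (auto dest: order_tendstoD(2))
  have mono: "Im (ln_Gamma z) \<le> Im (ln_Gamma (z + of_nat (Suc n)))" if "0 < Im z" for z
  proof -
    have "0 \<le> Im (Ln (z + of_nat j))" for j
      using Im_Ln_pos_lt[of "z + of_nat j"] that by (auto simp: complex_eq_iff)
    then show ?thesis
      using ln_Gamma_plus_of_nat[OF that, of "Suc n"] by (simp add: sum_nonneg del: of_nat_Suc sum.lessThan_Suc)
  qed
  have "\<forall>\<^sub>F z in at p within upper_half_plane. z \<in> upper_half_plane"
    by (simp add: eventually_at_filter)
  with ev show ?thesis
    by eventually_elim (use mono in force)
qed

subsection \<open>The image of the upper half plane\<close>

lemma isCont_ln_Gamma_upper: "0 < Im z \<Longrightarrow> isCont ln_Gamma z"
  by (intro isCont_ln_Gamma_complex continuous_ident upper_half_plane_notin_nonpos_Reals)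

lemma continuous_on_ln_Gamma_upper: "A \<subseteq> upper_half_plane \<Longrightarrow> continuous_on A ln_Gamma"
  by (intro continuous_at_imp_continuous_on ballI isCont_ln_Gamma_upper) auto

lemma open_ln_Gamma_image:
  assumes "open A" "A \<subseteq> upper_half_plane"
  shows "open (ln_Gamma ` A)"
  using invariance_of_domain[OF continuous_on_ln_Gamma_upper] inj_on_subset[OF inj_on_ln_Gamma] assms
  by blast

text \<open>Properness keeps the \<open>z n\<close> bounded, so a subsequence converges. Its limit
  is not a pole, because \<open>rGamma\<close> has the nonzero value \<open>exp (- l)\<close>
  there.\<close>

lemma ln_Gamma_preimage_limit:
  assumes "\<And>n. 0 < Im (z n)" "(\<lambda>n. ln_Gamma (z n)) \<longlonglongrightarrow> l"
  obtains w and r :: "nat \<Rightarrow> nat"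
  where "strict_mono r" "(\<lambda>n. z (r n)) \<longlonglongrightarrow> w" "0 \<le> Im w" "w \<notin> \<int>\<^sub>\<le>\<^sub>0" "rGamma w = exp (- l)"
proof -
  obtain M where M: "\<And>n. norm (ln_Gamma (z n)) \<le> M"
    using convergent_imp_bounded[OF assms(2)] by (auto simp: bounded_iff)
  obtain R where "\<And>z. 0 < Im z \<Longrightarrow> norm (ln_Gamma z) \<le> M \<Longrightarrow> norm z \<le> R"
    using ln_Gamma_bounded_imp_bounded by blast
  then have "bounded (range z)" using M assms(1) by (auto simp: bounded_iff)
  then obtain w r where wr: "strict_mono r" "(z \<circ> r) \<longlonglongrightarrow> w"
    using bounded_imp_convergent_subsequence by blast
  have lim: "(\<lambda>n. z (r n)) \<longlonglongrightarrow> w" using wr(2) by (simp add: o_def)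
  have "0 \<le> Im w"
    using tendsto_Im[OF lim] by (rule LIMSEQ_le_const) (use assms(1) less_imp_le in blast)
  moreover have "(\<lambda>n. rGamma (z (r n))) \<longlonglongrightarrow> rGamma w"
    using isCont_tendsto_compose[OF isCont_rGamma[OF continuous_ident] lim] .
  moreover have "(\<lambda>n. rGamma (z (r n))) \<longlonglongrightarrow> exp (- l)"
  proof -
    have "(\<lambda>n. ln_Gamma (z (r n))) \<longlonglongrightarrow> l"
      using LIMSEQ_subseq_LIMSEQ[OF assms(2) wr(1)] by (simp add: o_def)
    from tendsto_exp[OF tendsto_minus[OF this]] show ?thesis
      using exp_minus_ln_Gamma[OF assms(1)] by simp
  qed
  ultimately have "0 \<le> Im w" "rGamma w = exp (- l)" using LIMSEQ_unique by blast+
  moreover from this(2) have "w \<notin> \<int>\<^sub>\<le>\<^sub>0" by (auto simp flip: rGamma_eq_zero_iff)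
  ultimately show thesis using that wr lim by blast
qed

text \<open>Preimages subconverge either to a point of the open half plane, where
  \<open>ln_Gamma\<close> is continuous, or to a real point off the poles, where the boundary value
  is the limit.\<close>

lemma closure_ln_Gamma_image:
  assumes "l \<in> closure (ln_Gamma ` upper_half_plane)"
  shows "l \<in> ln_Gamma ` upper_half_plane \<or> (\<exists>x. x \<notin> \<int>\<^sub>\<le>\<^sub>0 \<and> l = ln_Gamma_boundary x)"
proof -
  obtain f where f: "\<And>n. f n \<in> ln_Gamma ` upper_half_plane" "f \<longlonglongrightarrow> l"
    using assms unfolding closure_sequential by blast
  have "\<forall>n. \<exists>z. 0 < Im z \<and> f n = ln_Gamma z" using f(1) by blast
  then obtain z where z: "\<And>n. 0 < Im (z n)" "\<And>n. f n = ln_Gamma (z n)" by metis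
  from f(2) have "(\<lambda>n. ln_Gamma (z n)) \<longlonglongrightarrow> l" by (simp add: z(2)[symmetric])
  from ln_Gamma_preimage_limit[OF z(1) this] obtain w r
    where wr: "strict_mono r" "(\<lambda>n. z (r n)) \<longlonglongrightarrow> w" "0 \<le> Im w" "w \<notin> \<int>\<^sub>\<le>\<^sub>0" .
  have lim: "(\<lambda>n. ln_Gamma (z (r n))) \<longlonglongrightarrow> l"
    using LIMSEQ_subseq_LIMSEQ[OF \<open>(\<lambda>n. ln_Gamma (z n)) \<longlonglongrightarrow> l\<close> wr(1)] by (simp add: o_def)
  show ?thesis
  proof (cases "Im w = 0")
    case False
    then have "(\<lambda>n. ln_Gamma (z (r n))) \<longlonglongrightarrow> ln_Gamma w"
      using isCont_tendsto_compose[OF isCont_ln_Gamma_upper wr(2)] wr(3) by simp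
    with lim have "l = ln_Gamma w" using LIMSEQ_unique by blast
    then show ?thesis using False wr(3) by auto
  next
    case True
    then have w: "w = of_real (Re w)" by (simp add: complex_eq_iff)
    then have x: "Re w \<notin> \<int>\<^sub>\<le>\<^sub>0" using wr(4) by (metis of_real_in_nonpos_Ints_iff)
    have "filterlim (\<lambda>n. z (r n)) (at (of_real (Re w)) within upper_half_plane) sequentially"
      using wr(2) z(1) True w unfolding filterlim_at
      by (auto intro!: always_eventually) (metis less_irrefl)
    from filterlim_compose[OF tendsto_ln_Gamma_boundary[OF x] this] lim
    have "l = ln_Gamma_boundary (Re w)" using LIMSEQ_unique by blast
    with x show ?thesis by blast
  qed
qed

text \<open>If \<open>z0\<close> took the boundary value, the open image of a half plane
  \<open>U\<close> around \<open>z0\<close>, at positive distance from the real axis, would contain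
  \<open>ln_Gamma z\<close> for all \<open>z\<close> near \<open>x\<close>; this contradicts
  injectivity.\<close>

lemma ln_Gamma_boundary_notin_image:
  assumes "x \<notin> \<int>\<^sub>\<le>\<^sub>0"
  shows "ln_Gamma_boundary x \<notin> ln_Gamma ` upper_half_plane"
proof
  assume "ln_Gamma_boundary x \<in> ln_Gamma ` upper_half_plane"
  then obtain z0 where z0: "0 < Im z0" "ln_Gamma_boundary x = ln_Gamma z0" by auto
  define U where "U = {z. Im z0 / 2 < Im z}"
  have "open U" unfolding U_def by (rule open_halfspace_Im_gt)
  moreover have U: "U \<subseteq> upper_half_plane" using z0 by (auto simp: U_def)
  ultimately have "open (ln_Gamma ` U)" by (rule open_ln_Gamma_image)
  moreover have "ln_Gamma_boundary x \<in> ln_Gamma ` U" using z0 by (auto simp: U_def)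
  ultimately have 1: "\<forall>\<^sub>F z in at (of_real x) within upper_half_plane. ln_Gamma z \<in> ln_Gamma ` U"
    using tendsto_ln_Gamma_boundary[OF assms] by (rule topological_tendstoD[rotated])
  have 2: "\<forall>\<^sub>F z in at (of_real x) within upper_half_plane. z \<in> upper_half_plane"
    by (simp add: eventually_at_filter)
  have "(Im \<longlongrightarrow> 0) (at (of_real x) within upper_half_plane)"
    using tendsto_Im[OF tendsto_ident_at, of "of_real x" upper_half_plane] by simp
  from order_tendstoD(2)[OF this, of "Im z0 / 2"]
  have 3: "\<forall>\<^sub>F z in at (of_real x) within upper_half_plane. Im z < Im z0 / 2"
    using z0 by simp
  from 1 2 3 have "\<forall>\<^sub>F z in at (of_real x) within upper_half_plane. False"
  proof eventually_elim
    case (elim z)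
    then obtain u where u: "u \<in> U" "ln_Gamma z = ln_Gamma u" by auto
    then have "z = u" using inj_onD[OF inj_on_ln_Gamma] elim U by blast
    with u elim show False by (simp add: U_def)
  qed
  then show False using at_within_upper_half_plane_nontrivial by simp
qed

lemma notin_nonpos_Ints_between:
  fixes x :: real
  assumes "of_int m < x" "x < of_int m + 1"
  shows "x \<notin> \<int>\<^sub>\<le>\<^sub>0"
proof
  assume "x \<in> \<int>\<^sub>\<le>\<^sub>0"
  then obtain n where "x = real_of_int n" by (elim nonpos_Ints_cases)
  with assms have "real_of_int m < real_of_int n" "real_of_int n < real_of_int (m + 1)" by simp_all
  then show False unfolding of_int_less_iff by linarith
qed

section \<open>Horizontal strips in the logarithmic plane and their slits\<close>

definition log_strip :: "int \<Rightarrow> complex set" where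
  "log_strip k = {l. (2 * of_int k - 1) * pi < Im l \<and> Im l < (2 * of_int k + 1) * pi}"

text \<open>The boundary values inside the strip \<open>k\<close>: those whose height is an odd
  multiple of \<open>pi\<close> lie on edges of strips, and \<open>2 * k * pi\<close> is the only
  remaining height in this strip.\<close>

definition log_slit :: "int \<Rightarrow> complex set" where
  "log_slit k = {ln_Gamma_boundary x |x. x \<notin> \<int>\<^sub>\<le>\<^sub>0 \<and> min 0 \<lfloor>x\<rfloor> = 2 * k}"

lemma ln_Gamma_boundary_in_strip_iff:
  "ln_Gamma_boundary x \<in> log_strip k \<longleftrightarrow> min 0 \<lfloor>x\<rfloor> = 2 * k"
proof -
  have "ln_Gamma_boundary x \<in> log_strip k \<longleftrightarrow>
      real_of_int (2 * k - 1) * pi < real_of_int (min 0 \<lfloor>x\<rfloor>) * pi \<and>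
      real_of_int (min 0 \<lfloor>x\<rfloor>) * pi < real_of_int (2 * k + 1) * pi"
    by (simp add: log_strip_def ln_Gamma_boundary_def mult.commute)
  also have "\<dots> \<longleftrightarrow> 2 * k - 1 < min 0 \<lfloor>x\<rfloor> \<and> min 0 \<lfloor>x\<rfloor> < 2 * k + 1"
    by (simp only: mult_less_cancel_right_pos[OF pi_gt_zero] of_int_less_iff)
  also have "\<dots> \<longleftrightarrow> min 0 \<lfloor>x\<rfloor> = 2 * k" by linarith
  finally show ?thesis .
qed

lemma log_slit_positive: "0 < k \<Longrightarrow> log_slit k = {}"
  by (auto simp: log_slit_def)

text \<open>\<open>\<bar>rGamma\<bar>\<close> is continuous on the whole line and vanishes exactly
  at the poles, hence easier to handle than \<open>ln \<bar>Gamma\<bar>\<close>. If its maximum on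
  the interval is \<open>exp (- m)\<close>, the intermediate value theorem between the pole
  \<open>a\<close> and the maximum yields all smaller positive values.\<close>

lemma log_slit_nonpositive:
  assumes "k \<le> 0"
  shows "\<exists>m. log_slit k = {l. Im l = 2 * of_int k * pi \<and> m \<le> Re l}"
proof -
  define f where "f = (\<lambda>x::real. \<bar>rGamma x\<bar>)"
  \<comment> \<open>For \<open>k < 0\<close> both ends are poles. For \<open>k = 0\<close> the
    interval is infinite; it is cut off at \<open>3 / 2\<close>, since \<open>Gamma\<close>
    increases from there on and the maximum of \<open>f\<close> is attained earlier.\<close>
  define a b where "a = real_of_int (2 * k)" and "b = (if k = 0 then 3 / 2 else real_of_int (2 * k) + 1)"
  have ab: "a < b" by (auto simp: a_def b_def)
  have a: "a \<in> \<int>\<^sub>\<le>\<^sub>0" unfolding a_def using assms by (intro nonpos_Ints_of_int) auto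
  have f0: "f x = 0 \<longleftrightarrow> x \<in> \<int>\<^sub>\<le>\<^sub>0" for x by (simp add: f_def rGamma_eq_zero_iff)
  have cont: "continuous_on A f" for A unfolding f_def by (intro continuous_intros)
  obtain xm where xm: "xm \<in> {a..b}" "\<And>x. x \<in> {a..b} \<Longrightarrow> f x \<le> f xm"
    using continuous_attains_sup[of "{a..b}" f] cont ab by auto
  have nonpole: "x \<notin> \<int>\<^sub>\<le>\<^sub>0" if "a < x" "x < a + 1" for x
    using that unfolding a_def by (rule notin_nonpos_Ints_between)
  have fpos: "0 < f xm"
  proof -
    have "0 < f (a + 1 / 2)" using f0[of "a + 1 / 2"] nonpole[of "a + 1 / 2"] by (simp add: f_def)
    also have "\<dots> \<le> f xm" by (intro xm) (auto simp: a_def b_def)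
    finally show ?thesis .
  qed
  define m where "m = - ln (f xm)"
  have Ref: "Re (ln_Gamma_boundary x) = - ln (f x)" if "x \<notin> \<int>\<^sub>\<le>\<^sub>0" for x
    using that f0[of x] by (simp add: ln_Gamma_boundary_def f_def rGamma_inverse_Gamma ln_inverse Gamma_eq_zero_iff)
  have Imf: "Im (ln_Gamma_boundary x) = 2 * of_int k * pi" if "min 0 \<lfloor>x\<rfloor> = 2 * k" for x
    unfolding ln_Gamma_boundary_def using that by simp
  have floor_iff: "min 0 \<lfloor>x\<rfloor> = 2 * k \<longleftrightarrow> a \<le> x \<and> (k = 0 \<or> x < b)" for x
    using assms by (auto simp: a_def b_def min_def floor_eq_iff le_floor_iff split: if_splits)
  have le: "f x \<le> f xm" if "x \<notin> \<int>\<^sub>\<le>\<^sub>0" "min 0 \<lfloor>x\<rfloor> = 2 * k" for x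
  proof (cases "x \<le> b")
    case True
    then show ?thesis using xm(2)[of x] that floor_iff[of x] by auto
  next
    case False
    then have k: "k = 0" "b = 3 / 2" using that floor_iff[of x] by (auto simp: b_def)
    have "Gamma (3 / 2) < Gamma x" using False k by (intro Gamma_real_strict_mono) auto
    then have "inverse (Gamma x) < inverse (Gamma (3 / 2))"
      by (intro less_imp_inverse_less) (auto intro: Gamma_real_pos)
    then have "f x \<le> f (3 / 2)" using False k
      by (simp add: f_def rGamma_inverse_Gamma Gamma_real_pos abs_of_pos)
    also have "\<dots> \<le> f xm" using ab k by (intro xm) auto
    finally show ?thesis .
  qed
  have "log_slit k = {l. Im l = 2 * of_int k * pi \<and> m \<le> Re l}"
  proof (intro equalityI subsetI)
    fix l assume "l \<in> log_slit k"
    then obtain x where x: "l = ln_Gamma_boundary x" "x \<notin> \<int>\<^sub>\<le>\<^sub>0" "min 0 \<lfloor>x\<rfloor> = 2 * k"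
      unfolding log_slit_def by blast
    have "0 < f x" using f0[of x] x by (simp add: f_def)
    then have "m \<le> Re l" using le[of x] x Ref[of x] fpos by (simp add: m_def)
    with x Imf show "l \<in> {l. Im l = 2 * of_int k * pi \<and> m \<le> Re l}" by simp
  next
    fix l assume "l \<in> {l. Im l = 2 * of_int k * pi \<and> m \<le> Re l}"
    then have l: "Im l = 2 * of_int k * pi" "m \<le> Re l" by auto
    have "- Re l \<le> ln (f xm)" using l by (simp add: m_def)
    then have "exp (- Re l) \<le> f xm" using fpos by (simp add: ln_ge_iff)
    moreover have "f a \<le> exp (- Re l)" using a f0[of a] by simp
    ultimately obtain x where x: "a \<le> x" "x \<le> xm" "f x = exp (- Re l)"
      using IVT'[of f a "exp (- Re l)" xm] cont xm(1) by auto
    have np: "x \<notin> \<int>\<^sub>\<le>\<^sub>0" using f0[of x] x(3) by simp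
    \<comment> \<open>For \<open>k < 0\<close> the right end \<open>b\<close> is a pole, where
      \<open>f\<close> vanishes, so \<open>x\<close> cannot be equal to it.\<close>
    have "k = 0 \<or> x < b"
    proof (rule ccontr)
      assume "\<not> (k = 0 \<or> x < b)"
      then have "x = real_of_int (2 * k + 1)" "2 * k + 1 \<le> 0"
        using x xm(1) assms by (auto simp: b_def)
      then show False using np by (metis nonpos_Ints_of_int)
    qed
    then have "min 0 \<lfloor>x\<rfloor> = 2 * k" using floor_iff x by blast
    moreover from this have "l = ln_Gamma_boundary x"
      using Imf[of x] Ref[OF np] x(3) l(1) by (simp add: complex_eq_iff)
    ultimately show "l \<in> log_slit k" using np unfolding log_slit_def by blast
  qed
  then show ?thesis by blast
qed

text \<open>The centre lies on the line of the slit, to the left of its tip. A segment from there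
  either leaves this line at once or runs inside it and ends before the tip.\<close>

lemma starlike_strip_minus_slit:
  assumes "a < c" "c < b"
  shows "starlike {l. a < Im l \<and> Im l < b \<and> \<not> (Im l = c \<and> m \<le> Re l)}" (is "starlike ?S")
  unfolding starlike_def
proof (intro bexI ballI subsetI)
  let ?p = "Complex (m - 1) c"
  show "?p \<in> ?S" using assms by auto
  fix q u assume q: "q \<in> ?S" and "u \<in> closed_segment ?p q"
  then obtain t where t: "0 \<le> t" "t \<le> 1" "u = (1 - t) *\<^sub>R ?p + t *\<^sub>R q"
    unfolding closed_segment_def by blast
  have "closed_segment ?p q \<subseteq> {l. a < Im l} \<inter> {l. Im l < b}"
    using q assms
    by (intro closed_segment_subset convex_Int convex_halfspace_Im_gt convex_halfspace_Im_lt) auto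
  with \<open>u \<in> closed_segment ?p q\<close> have "a < Im u" "Im u < b" by auto
  moreover have "Re u < m" if "Im u = c"
  proof -
    have "t * (Im q - c) = 0" using that unfolding t(3) by (simp add: algebra_simps)
    then consider "t = 0" | "Im q = c" by auto
    then show ?thesis
    proof cases
      case 2
      then have "Re q < m" using q by auto
      then have "(1 - t) * (m - 1) + t * Re q < m" using t(1,2)
        by (intro convex_bound_lt) auto
      then show ?thesis unfolding t(3) by simp
    qed (simp add: t(3))
  qed
  ultimately show "u \<in> ?S" by auto
qed

lemma starlike_log_region: "starlike (log_strip k - log_slit k)"
proof (cases "k \<le> 0")
  case True
  then obtain m where m: "log_slit k = {l. Im l = 2 * of_int k * pi \<and> m \<le> Re l}"
    using log_slit_nonpositive by blast
  have "log_strip k - log_slit k = {l. (2 * of_int k - 1) * pi < Im l \<and> Im l < (2 * of_int k + 1) * pi \<and>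
      \<not> (Im l = 2 * of_int k * pi \<and> m \<le> Re l)}"
    unfolding m log_strip_def by auto
  also have "starlike \<dots>"
    by (intro starlike_strip_minus_slit) auto
  finally show ?thesis .
next
  case False
  have "Complex 0 (2 * of_int k * pi) \<in> log_strip k" by (auto simp: log_strip_def)
  moreover have "convex (log_strip k)"
  proof -
    have "log_strip k = {l. (2 * of_int k - 1) * pi < Im l} \<inter> {l. Im l < (2 * of_int k + 1) * pi}"
      by (auto simp: log_strip_def)
    then show ?thesis by (simp add: convex_Int convex_halfspace_Im_gt convex_halfspace_Im_lt)
  qed
  ultimately show ?thesis
    using False log_slit_positive[of k] by (auto intro: convex_imp_starlike)
qed

section \<open>Determination of the image by connectedness\<close>

lemma connected_subset_if_no_boundary:
  fixes A S :: "'a::topological_space set"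
  assumes "connected S" "open A" "S \<inter> A \<noteq> {}" "S \<inter> closure A \<subseteq> A"
  shows "S \<subseteq> A"
proof -
  have "openin (top_of_set S) (S \<inter> A)" using assms(2) by (simp add: openin_open_Int)
  moreover have "S \<inter> A = S \<inter> closure A" using assms(4) closure_subset by blast
  then have "closedin (top_of_set S) (S \<inter> A)" by (simp add: closedin_closed_Int)
  ultimately have "S \<inter> A = {} \<or> S \<inter> A = S" using assms(1) unfolding connected_clopen by blast
  with assms(3) show ?thesis by blast
qed

lemma Im_ln_Gamma_boundary_nonpos: "Im (ln_Gamma_boundary x) \<le> 0"
  by (simp add: ln_Gamma_boundary_def mult_le_0_iff min_def)

lemma open_upper_half_plane: "open upper_half_plane"
  by (rule open_halfspace_Im_gt)

text \<open>\<open>ln_Gamma\<close> is real at \<open>3 / 2\<close>, and moving upwards from there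
  its imaginary part grows at the initial rate \<open>Digamma (3 / 2) > 0\<close>.\<close>

lemma Im_ln_Gamma_positive_exists: "\<exists>z. 0 < Im z \<and> 0 < Im (ln_Gamma z)"
proof -
  define g where "g = (\<lambda>y::real. 3 / 2 + \<i> * of_real y)"
  have "(g has_vector_derivative \<i>) (at 0)"
    unfolding g_def by (auto intro!: derivative_eq_intros)
  moreover have "(ln_Gamma has_field_derivative Digamma (3 / 2)) (at (g 0))"
    unfolding g_def by (auto intro!: derivative_eq_intros simp: complex_nonpos_Reals_iff)
  ultimately have "((ln_Gamma \<circ> g) has_vector_derivative \<i> * Digamma (3 / 2)) (at 0)"
    by (rule field_vector_diff_chain_at)
  from has_field_derivative_Im[OF this]
  have "((\<lambda>y. Im (ln_Gamma (g y))) has_real_derivative Re (Digamma (3 / 2))) (at 0)"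
    by (simp add: o_def)
  moreover have "Re (Digamma (3 / 2 :: complex)) = Digamma (3 / 2 :: real)"
    using Polygamma_of_real[of "3 / 2 :: real" 0, where 'a = complex] by (metis Re_complex_of_real divide_eq_0_iff of_real_divide of_real_numeral zero_neq_numeral)
  ultimately obtain d where d: "d > 0" "\<And>h. 0 < h \<Longrightarrow> h < d \<Longrightarrow> Im (ln_Gamma (g 0)) < Im (ln_Gamma (g (0 + h)))"
    using DERIV_pos_inc_right[of "\<lambda>y. Im (ln_Gamma (g y))" _ 0] Digamma_real_three_halves_pos by auto
  have "Im (ln_Gamma (g 0)) = 0"
    using ln_Gamma_complex_of_real[of "3 / 2"] by (simp add: g_def)
  then show ?thesis
    using d(1) d(2)[of "d / 2"] by (intro exI[of _ "g (d / 2)"]) (auto simp: g_def)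
qed

text \<open>No boundary value has positive imaginary part, so the connected upper half plane
  contains no boundary point of the image.\<close>

lemma upper_half_plane_subset_ln_Gamma_image: "upper_half_plane \<subseteq> ln_Gamma ` upper_half_plane"
proof (rule connected_subset_if_no_boundary)
  show "connected upper_half_plane" by (intro convex_connected convex_halfspace_Im_gt)
  show "open (ln_Gamma ` upper_half_plane)" by (intro open_ln_Gamma_image open_upper_half_plane order.refl)
  show "upper_half_plane \<inter> ln_Gamma ` upper_half_plane \<noteq> {}"
    using Im_ln_Gamma_positive_exists by auto
  show "upper_half_plane \<inter> closure (ln_Gamma ` upper_half_plane) \<subseteq> ln_Gamma ` upper_half_plane"
  proof
    fix l assume "l \<in> upper_half_plane \<inter> closure (ln_Gamma ` upper_half_plane)"
    then show "l \<in> ln_Gamma ` upper_half_plane"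
      using closure_ln_Gamma_image[of l] Im_ln_Gamma_boundary_nonpos by (auto simp: not_less[symmetric])
  qed
qed

text \<open>The heights form a connected set. It is unbounded below by the boundary values far to
  the left, and unbounded above by the preceding lemma; hence the image meets every strip.\<close>

lemma Im_ln_Gamma_surj: "\<exists>z. 0 < Im z \<and> Im (ln_Gamma z) = t"
proof -
  define A where "A = (\<lambda>z. Im (ln_Gamma z)) ` upper_half_plane"
  have "connected A" unfolding A_def
    by (intro connected_continuous_image continuous_intros continuous_on_ln_Gamma_upper convex_connected
        convex_halfspace_Im_gt order.refl)
  moreover obtain z1 where z1: "0 < Im z1" "Im (ln_Gamma z1) < t"
  proof -
    define j where "j = nat \<lceil>\<bar>t\<bar>\<rceil> + 1"
    \<comment> \<open>The midpoint between the poles \<open>- j\<close> and \<open>- j + 1\<close>,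
      where the boundary value has height \<open>- pi * j\<close>.\<close>
    define x where "x = 1 / 2 - real j"
    have floor: "\<lfloor>x\<rfloor> = - int j" unfolding x_def by (simp add: floor_eq_iff)
    have "x \<notin> \<int>\<^sub>\<le>\<^sub>0"
      by (rule notin_nonpos_Ints_between[of "- int j"]) (auto simp: x_def)
    have "\<bar>t\<bar> < real j" unfolding j_def by linarith
    moreover have "real j \<le> pi * real j" using mult_right_mono[of 1 pi "real j"] pi_ge_two by simp
    moreover have "Im (ln_Gamma_boundary x) = - (pi * real j)"
      by (simp add: ln_Gamma_boundary_def floor min_def)
    ultimately have "Im (ln_Gamma_boundary x) < t" by linarith
    from order_tendstoD(2)[OF tendsto_Im[OF tendsto_ln_Gamma_boundary[OF \<open>x \<notin> \<int>\<^sub>\<le>\<^sub>0\<close>]] this]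
    have "\<forall>\<^sub>F z in at (of_real x) within upper_half_plane. 0 < Im z \<and> Im (ln_Gamma z) < t"
      by (simp add: eventually_at_filter eventually_mono)
    from eventually_happens'[OF at_within_upper_half_plane_nontrivial this] show ?thesis using that by blast
  qed
  moreover obtain z2 where z2: "0 < Im z2" "t < Im (ln_Gamma z2)"
  proof -
    have "Complex 0 (\<bar>t\<bar> + 1) \<in> upper_half_plane" by simp
    then obtain z where "0 < Im z" "ln_Gamma z = Complex 0 (\<bar>t\<bar> + 1)"
      using upper_half_plane_subset_ln_Gamma_image by (metis (mono_tags, lifting) imageE in_mono mem_Collect_eq)
    then show ?thesis using that[of z] by simp
  qed
  ultimately have "t \<in> A"
    using connectedD_interval[of A "Im (ln_Gamma z1)" "Im (ln_Gamma z2)" t] unfolding A_def by auto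
  then show ?thesis by (auto simp: A_def)
qed

text \<open>The slit strip is connected, meets the image, and contains no boundary value of
  \<open>ln_Gamma\<close>, so it lies in the image.\<close>

lemma ln_Gamma_image_strip:
  "ln_Gamma ` upper_half_plane \<inter> log_strip k = log_strip k - log_slit k"
proof
  have notin: "l \<notin> ln_Gamma ` upper_half_plane" if "l \<in> log_slit k" for l
    using that ln_Gamma_boundary_notin_image by (auto simp: log_slit_def)
  then show "ln_Gamma ` upper_half_plane \<inter> log_strip k \<subseteq> log_strip k - log_slit k"
    by blast
  have "log_strip k - log_slit k \<subseteq> ln_Gamma ` upper_half_plane"
  proof (rule connected_subset_if_no_boundary)
    show "connected (log_strip k - log_slit k)"
      by (intro starlike_imp_connected starlike_log_region)
    show "open (ln_Gamma ` upper_half_plane)" by (intro open_ln_Gamma_image open_upper_half_plane order.refl)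
    obtain z where z: "0 < Im z" "Im (ln_Gamma z) = (2 * of_int k + 1 / 2) * pi"
      using Im_ln_Gamma_surj by blast
    have "ln_Gamma z \<in> log_strip k" using z by (simp add: log_strip_def)
    moreover have "ln_Gamma z \<notin> log_slit k"
      using notin z(1) by blast
    ultimately show "(log_strip k - log_slit k) \<inter> ln_Gamma ` upper_half_plane \<noteq> {}" using z by auto
    show "(log_strip k - log_slit k) \<inter> closure (ln_Gamma ` upper_half_plane) \<subseteq> ln_Gamma ` upper_half_plane"
    proof
      fix l assume "l \<in> (log_strip k - log_slit k) \<inter> closure (ln_Gamma ` upper_half_plane)"
      then have l: "l \<in> log_strip k" "l \<notin> log_slit k" "l \<in> closure (ln_Gamma ` upper_half_plane)"
        by auto
      have "l \<noteq> ln_Gamma_boundary x" if "x \<notin> \<int>\<^sub>\<le>\<^sub>0" for x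
        using l(1,2) that ln_Gamma_boundary_in_strip_iff[of x k] by (auto simp: log_slit_def)
      with closure_ln_Gamma_image[OF l(3)] show "l \<in> ln_Gamma ` upper_half_plane" by blast
    qed
  qed
  then show "log_strip k - log_slit k \<subseteq> ln_Gamma ` upper_half_plane \<inter> log_strip k" by blast
qed

subsection \<open>Topology of the sphere\<close>

lemma openin_riemann_sphere:
  "openin riemann_sphere V \<longleftrightarrow> (\<exists>U. open U \<and> V = Some ` U) \<or> (\<exists>K. compact K \<and> V = - Some ` K)"
proof -
  have "insert None (Some ` (UNIV - K)) = - Some ` K" for K :: "complex set"
  proof (intro set_eqI)
    show "w \<in> insert None (Some ` (UNIV - K)) \<longleftrightarrow> w \<in> - Some ` K" for w by (cases w) auto
  qed
  then show ?thesis
    by (auto simp: openin_Alexandroff_compactification compact_imp_closed)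
qed

text \<open>Without common zeros of \<open>p\<close> and \<open>q\<close> the quotient is a
  continuous point of the projective line; this is what makes the slit parametrisation continuous at
  infinity.\<close>

lemma continuous_map_sphere_quotient:
  fixes p q :: "'a::topological_space \<Rightarrow> complex"
  assumes "continuous_on S p" "continuous_on S q" "\<And>t. t \<in> S \<Longrightarrow> q t = 0 \<Longrightarrow> p t \<noteq> 0"
  shows "continuous_map (top_of_set S) riemann_sphere (\<lambda>t. if q t = 0 then None else Some (p t / q t))"
    (is "continuous_map _ _ ?f")
proof -
  have openin_preimage: "openin (top_of_set S) {t \<in> S. ?f t \<in> Some ` U}" if "open U" for U
  proof -
    define S' where "S' = S \<inter> q -` (- {0})"
    have "openin (top_of_set S) S'"
      unfolding S'_def by (rule continuous_openin_preimage_gen[OF assms(2)]) auto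
    moreover have "openin (top_of_set S') (S' \<inter> (\<lambda>t. p t / q t) -` U)"
      using that by (intro continuous_openin_preimage_gen continuous_intros continuous_on_subset[OF assms(1)]
          continuous_on_subset[OF assms(2)]) (auto simp: S'_def)
    moreover have "{t \<in> S. ?f t \<in> Some ` U} = S' \<inter> (\<lambda>t. p t / q t) -` U"
      by (auto simp: S'_def)
    ultimately show ?thesis using openin_trans by simp
  qed
  have closedin_preimage: "closedin (top_of_set S) {t \<in> S. ?f t \<in> Some ` K}" if K: "compact K" for K
  proof -
    obtain R where R: "\<And>z. z \<in> K \<Longrightarrow> norm z \<le> R"
      using compact_imp_bounded[OF K] by (auto simp: bounded_iff)
    \<comment> \<open>The preimage of \<open>K\<close> lies in the closed set \<open>T\<close>, on
      which \<open>q\<close> has no zero because \<open>p\<close> would vanish with it; there the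
      quotient is an ordinary continuous function.\<close>
    define T where "T = {t \<in> S. norm (p t) \<le> R * norm (q t)}"
    have "closedin (top_of_set S) (S \<inter> (\<lambda>t. norm (p t) - R * norm (q t)) -` {..0})"
      by (intro continuous_closedin_preimage continuous_intros assms(1,2))
    then have T: "closedin (top_of_set S) T"
      by (rule back_subst[of "closedin (top_of_set S)"]) (auto simp: T_def)
    have q: "q t \<noteq> 0" if "t \<in> T" for t using that assms(3) by (auto simp: T_def)
    have "closedin (top_of_set T) (T \<inter> (\<lambda>t. p t / q t) -` K)"
      using K q by (intro continuous_closedin_preimage continuous_intros continuous_on_subset[OF assms(1)]
          continuous_on_subset[OF assms(2)] compact_imp_closed) (auto simp: T_def)
    moreover have "{t \<in> S. ?f t \<in> Some ` K} = T \<inter> (\<lambda>t. p t / q t) -` K"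
    proof -
      have "norm (p t) \<le> R * norm (q t)" if "q t \<noteq> 0" "p t / q t \<in> K" for t
        using R[OF that(2)] that(1) by (simp add: norm_divide divide_le_eq)
      then show ?thesis using q by (auto simp: T_def split: if_splits)
    qed
    ultimately show ?thesis using closedin_trans[OF _ T] by simp
  qed
  show ?thesis unfolding continuous_map
  proof (intro conjI allI impI)
    fix U assume "openin riemann_sphere U"
    then consider U' where "open U'" "U = Some ` U'" | K where "compact K" "U = - Some ` K"
      by (auto simp: openin_riemann_sphere)
    then show "openin (top_of_set S) {t \<in> topspace (top_of_set S). ?f t \<in> U}"
    proof cases
      case 1
      then show ?thesis using openin_preimage by simp
    next
      case 2
      have "{t \<in> topspace (top_of_set S). ?f t \<in> U} = S - {t \<in> S. ?f t \<in> Some ` K}"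
        using 2 by auto
      then show ?thesis
        using openin_diff[OF openin_subtopology_self closedin_preimage[OF 2(1)]] by simp
    qed
  qed (simp add: UNIV_option_conv[symmetric])
qed

section \<open>Neighbourhoods of infinity, closures and slits in the sphere\<close>

lemma openin_riemann_sphere_None:
  assumes "openin riemann_sphere U" "None \<in> U"
  obtains K where "compact K" "U = - Some ` K"
  using assms by (auto simp: openin_riemann_sphere)

lemma Some_in_sphere_closure_iff: "Some z \<in> sphere_closure U \<longleftrightarrow> z \<in> closure U"
proof
  assume z: "Some z \<in> sphere_closure U"
  show "z \<in> closure U"
    unfolding closure_iff_nhds_not_empty
  proof (intro allI impI)
    fix A V assume "V \<subseteq> A" "open V" "z \<in> V"
    then have "\<exists>y\<in>Some ` U. y \<in> Some ` V"
      using z by (auto simp: in_closure_of)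
    then show "U \<inter> A \<noteq> {}" using \<open>V \<subseteq> A\<close> by auto
  qed
next
  assume z: "z \<in> closure U"
  show "Some z \<in> sphere_closure U"
    unfolding in_closure_of
  proof (intro conjI allI impI)
    fix T assume T: "Some z \<in> T \<and> openin riemann_sphere T"
    then have "openin euclidean {x \<in> topspace euclidean. Some x \<in> T}"
      by (intro openin_continuous_map_preimage[OF continuous_map_Some]) auto
    then have "open {x. Some x \<in> T}" by simp
    with T z have "U \<inter> {x. Some x \<in> T} \<noteq> {}"
      using open_Int_closure_eq_empty[of "{x. Some x \<in> T}" U] by blast
    then show "\<exists>y. y \<in> Some ` U \<and> y \<in> T" by auto
  qed simp
qed

lemma None_in_sphere_closure:
  assumes "\<not> bounded U"
  shows "None \<in> sphere_closure U"
  unfolding in_closure_of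
proof (intro conjI allI impI)
  fix T assume T: "None \<in> T \<and> openin riemann_sphere T"
  then obtain K where K: "compact K" "T = - Some ` K" using openin_riemann_sphere_None by blast
  then have "\<not> U \<subseteq> K" using assms compact_imp_bounded bounded_subset by blast
  then show "\<exists>y. y \<in> Some ` U \<and> y \<in> T" using K by auto
qed simp

lemma limitin_riemann_sphere_None:
  assumes "filterlim f at_infinity F"
  shows "limitin riemann_sphere (\<lambda>t. Some (f t)) None F"
  unfolding limitin_def
proof (intro conjI allI impI)
  fix U assume "openin riemann_sphere U \<and> None \<in> U"
  then obtain K where K: "compact K" "U = - Some ` K" using openin_riemann_sphere_None by blast
  then obtain R where R: "\<And>z. z \<in> K \<Longrightarrow> norm z \<le> R"
    using compact_imp_bounded[OF K(1)] by (auto simp: bounded_iff)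
  have "filterlim (\<lambda>t. norm (f t)) at_top F"
    using assms by (simp add: filterlim_at_infinity_conv_norm_at_top)
  then have "\<forall>\<^sub>F t in F. R < norm (f t)" by (simp add: filterlim_at_top_dense)
  then show "\<forall>\<^sub>F t in F. Some (f t) \<in> U"
    by eventually_elim (use R K in force)
qed simp

text \<open>The arc is the image of \<open>[0, 1]\<close> under the Moebius map
  \<open>M * t / (c * t - 1)\<close>. It runs from 0 along the negative axis to infinity, reached at
  \<open>t = 1 / c\<close>; for \<open>c = 1\<close> it ends there, for \<open>c = 2\<close> it
  returns along the positive axis down to \<open>M\<close>.\<close>

lemma real_slit_through_infinity:
  fixes M c :: real
  assumes "M > 0" "c = 1 \<or> c = 2"
  shows "real_slit (insert None (Some ` of_real ` ({..0} \<union> (if c = 2 then {M..} else {}))))" (is "real_slit ?L")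
proof -
  define g where "g = (\<lambda>t::real. if complex_of_real (c * t - 1) = 0 then None
      else Some (complex_of_real (M * t) / complex_of_real (c * t - 1)))"
  have g: "g t = (if c * t = 1 then None else Some (of_real (M * t / (c * t - 1))))" for t
    by (simp add: g_def flip: of_real_divide of_real_diff of_real_mult)
  have "pathin riemann_sphere g"
    unfolding pathin_def g_def
    by (intro continuous_map_sphere_quotient continuous_intros) (use assms(1) in \<open>auto simp flip: of_real_mult\<close>)
  moreover have "inj_on g {0..1}"
  proof (rule inj_onI)
    fix s t assume "g s = g t"
    then consider "c * s = 1" "c * t = 1"
      | "c * s \<noteq> 1" "c * t \<noteq> 1" "M * s / (c * s - 1) = M * t / (c * t - 1)"
      unfolding g by (auto simp del: of_real_divide of_real_mult of_real_diff split: if_splits)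
    then show "s = t"
    proof cases
      case 1
      then show ?thesis using assms(2) by auto
    next
      case 2
      then have "M * s * (c * t - 1) = M * t * (c * s - 1)" by (simp add: frac_eq_eq)
      then show ?thesis using assms(1) by (simp add: algebra_simps)
    qed
  qed
  moreover have "?L = g ` {0..1}"
  proof (intro equalityI subsetI)
    fix w assume "w \<in> ?L"
    then consider "w = None" | x where "w = Some (of_real x)" "x \<le> 0 \<or> (c = 2 \<and> M \<le> x)"
      by (auto split: if_splits)
    then show "w \<in> g ` {0..1}"
    proof cases
      case 1
      then have "w = g (1 / c)" "1 / c \<in> {0..1}" using assms(2) by (auto simp: g)
      then show ?thesis by blast
    next
      case 2
      \<comment> \<open>The inverse Moebius map.\<close>
      define t where "t = x / (c * x - M)"
      have nz: "c * x - M \<noteq> 0" using 2(2) assms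
        by (elim disjE) (auto simp: algebra_simps)
      then have "c * t - 1 = M / (c * x - M)"
        by (simp add: t_def field_simps)
      then have "M * t / (c * t - 1) = x" "c * t \<noteq> 1" using assms(1) nz by (auto simp: t_def field_simps)
      then have "w = g t" using 2 by (simp add: g)
      moreover have "t \<in> {0..1}" using 2(2)
      proof
        assume "x \<le> 0"
        then show ?thesis using assms
          by (auto simp: t_def divide_nonpos_neg divide_le_eq)
      next
        assume "c = 2 \<and> M \<le> x"
        then show ?thesis using assms(1) by (simp add: t_def divide_le_eq)
      qed
      ultimately show ?thesis by blast
    qed
  next
    fix w assume "w \<in> g ` {0..1}"
    then obtain t where t: "0 \<le> t" "t \<le> 1" "w = g t" by auto
    show "w \<in> ?L"
    proof (cases "c * t = 1")
      case True
      then show ?thesis using t by (simp add: g)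
    next
      case False
      define x where "x = M * t / (c * t - 1)"
      have "x \<le> 0 \<or> (c = 2 \<and> M \<le> x)"
      proof (cases "c * t < 1")
        case True
        then have "x \<le> 0" unfolding x_def using t assms(1) by (intro divide_nonneg_neg) auto
        then show ?thesis ..
      next
        case 2: False
        with False t assms(2) have c: "c = 2" "2 * t > 1" by auto
        have "M * (2 * t - 1) \<le> M * t" using t assms(1) by (intro mult_left_mono) auto
        then have "M \<le> x" unfolding x_def using c by (simp add: le_divide_eq)
        with c show ?thesis by simp
      qed
      moreover have "w = Some (of_real x)" using t False by (simp add: g x_def)
      ultimately show ?thesis by auto
    qed
  qed
  moreover have "?L \<subseteq> insert None (Some ` \<real>)" by auto
  ultimately show ?thesis unfolding real_slit_def by blast
qed

subsection \<open>The fundamental domains\<close>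

definition gamma_domain :: "int \<Rightarrow> complex set" where
  "gamma_domain k = {z. 0 < Im z \<and> ln_Gamma z \<in> log_strip k}"

lemma gamma_domain_subset: "gamma_domain k \<subseteq> upper_half_plane"
  by (auto simp: gamma_domain_def)

lemma open_log_strip: "open (log_strip k)"
proof -
  have "log_strip k = {l. (2 * of_int k - 1) * pi < Im l} \<inter> {l. Im l < (2 * of_int k + 1) * pi}"
    by (auto simp: log_strip_def)
  then show ?thesis by (simp add: open_Int open_halfspace_Im_gt open_halfspace_Im_lt)
qed

lemma open_gamma_domain: "open (gamma_domain k)"
proof -
  have "gamma_domain k = upper_half_plane \<inter> ln_Gamma -` log_strip k"
    by (auto simp: gamma_domain_def)
  then show ?thesis
    by (simp add: continuous_open_preimage continuous_on_ln_Gamma_upper open_upper_half_plane open_log_strip)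
qed

lemma ln_Gamma_image_gamma_domain: "ln_Gamma ` gamma_domain k = log_strip k - log_slit k"
  unfolding ln_Gamma_image_strip[symmetric] by (auto simp: gamma_domain_def)

lemma homeomorphism_gamma_domain:
  "\<exists>g. homeomorphism (gamma_domain k) (log_strip k - log_slit k) ln_Gamma g"
  using invariance_of_domain_homeomorphism[OF open_gamma_domain
      continuous_on_ln_Gamma_upper[OF gamma_domain_subset] order.refl
      inj_on_subset[OF inj_on_ln_Gamma gamma_domain_subset], of k]
  unfolding ln_Gamma_image_gamma_domain by blast

lemma simply_connected_gamma_domain: "simply_connected (gamma_domain k)"
  using homeomorphism_gamma_domain homeomorphic_simply_connected_eq[of "gamma_domain k"]
    starlike_imp_simply_connected[OF starlike_log_region]
  unfolding homeomorphic_def by blast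

lemma Im_log_slit: "l \<in> log_slit k \<Longrightarrow> Im l = 2 * of_int k * pi"
  unfolding log_slit_def ln_Gamma_boundary_def by auto

lemma gamma_domain_preimage:
  assumes "(2 * of_int k - 1) * pi < Im l" "Im l < (2 * of_int k + 1) * pi" "Im l \<noteq> 2 * of_int k * pi"
  obtains z where "z \<in> gamma_domain k" "ln_Gamma z = l"
proof -
  have "l \<in> ln_Gamma ` gamma_domain k"
    unfolding ln_Gamma_image_gamma_domain using assms Im_log_slit by (auto simp: log_strip_def)
  then show ?thesis using that by auto
qed

text \<open>The entire function \<open>rGamma\<close> is bounded on bounded sets, whereas the real
  part of \<open>ln_Gamma\<close> takes arbitrarily negative values on the domain and makes
  \<open>rGamma\<close> arbitrarily large.\<close>

lemma unbounded_gamma_domain: "\<not> bounded (gamma_domain k)"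
proof
  assume "bounded (gamma_domain k)"
  then have "compact (closure (gamma_domain k))" by simp
  then have "compact (rGamma ` closure (gamma_domain k))"
    by (intro compact_continuous_image continuous_on_rGamma)
  then obtain C where C: "\<And>z. z \<in> closure (gamma_domain k) \<Longrightarrow> norm (rGamma z) \<le> C"
    using compact_imp_bounded by (fastforce simp: bounded_iff)
  obtain z where z: "z \<in> gamma_domain k" "ln_Gamma z = Complex (- \<bar>C\<bar>) ((2 * of_int k + 1 / 2) * pi)"
    by (rule gamma_domain_preimage[of k "Complex (- \<bar>C\<bar>) ((2 * of_int k + 1 / 2) * pi)"]) auto
  have "rGamma z = exp (- ln_Gamma z)"
    using exp_minus_ln_Gamma[of z] z(1) by (auto simp: gamma_domain_def)
  then have "norm (rGamma z) = exp \<bar>C\<bar>" using z(2) by simp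
  moreover have "norm (rGamma z) \<le> C" using C z(1) closure_subset by blast
  ultimately show False using exp_ge_add_one_self[of "\<bar>C\<bar>"] by linarith
qed

section \<open>Values of \<open>Gamma\<close> on one domain and on its closure\<close>

lemma exp_ln_Gamma: "0 < Im z \<Longrightarrow> exp (ln_Gamma z) = Gamma z"
  using exp_minus_ln_Gamma[of z] by (simp add: exp_minus rGamma_inverse_Gamma)

lemma Ln_exp_strip:
  assumes "l \<in> log_strip k"
  shows "Ln (exp l) = l - 2 * of_int k * pi * \<i>"
proof -
  have "exp (l - 2 * of_int k * pi * \<i>) = exp l"
    unfolding exp_eq by (intro exI[of _ "- k"]) simp
  moreover have "Ln (exp (l - 2 * of_int k * pi * \<i>)) = l - 2 * of_int k * pi * \<i>"
    using assms by (intro Ln_exp) (auto simp: log_strip_def algebra_simps)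
  ultimately show ?thesis by simp
qed

lemma inj_on_Gamma_gamma_domain: "inj_on Gamma (gamma_domain k)"
proof (rule inj_onI)
  fix z w assume *: "z \<in> gamma_domain k" "w \<in> gamma_domain k" "Gamma z = Gamma w"
  then have "exp (ln_Gamma z) = exp (ln_Gamma w)" "ln_Gamma z \<in> log_strip k" "ln_Gamma w \<in> log_strip k"
    by (auto simp: gamma_domain_def exp_ln_Gamma)
  then have "ln_Gamma z = ln_Gamma w" using Ln_exp_strip by (metis diff_add_cancel)
  then show "z = w" using inj_onD[OF inj_on_ln_Gamma] * gamma_domain_subset by blast
qed

text \<open>The only candidate for a logarithm of \<open>v\<close> in the strip is
  \<open>Ln v + 2 * k * pi * \<i>\<close>. Negative reals drop out because their logarithms lie on
  the edges of strips.\<close>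

lemma Gamma_image_gamma_domain_iff:
  "v \<in> Gamma ` gamma_domain k \<longleftrightarrow> v \<notin> \<real>\<^sub>\<le>\<^sub>0 \<and> Ln v + 2 * of_int k * pi * \<i> \<notin> log_slit k"
proof -
  have "Gamma ` gamma_domain k = exp ` ln_Gamma ` gamma_domain k"
    unfolding image_image by (intro image_cong refl) (auto simp: gamma_domain_def exp_ln_Gamma)
  then have *: "v \<in> Gamma ` gamma_domain k \<longleftrightarrow> (\<exists>l\<in>log_strip k. l \<notin> log_slit k \<and> v = exp l)"
    unfolding ln_Gamma_image_gamma_domain by auto
  show ?thesis unfolding *
  proof (intro iffI conjI; (elim bexE conjE)?)
    fix l assume l: "l \<in> log_strip k" "l \<notin> log_slit k" "v = exp l"
    then have Ln: "Ln v = l - 2 * of_int k * pi * \<i>" by (simp add: Ln_exp_strip)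
    then show "Ln v + 2 * of_int k * pi * \<i> \<notin> log_slit k" using l by simp
    have "Im (Ln v) = Im l - 2 * of_int k * pi" unfolding Ln by simp
    then have "Im (Ln v) < pi" "v \<noteq> 0" using l(1,3) by (auto simp: log_strip_def algebra_simps)
    then show "v \<notin> \<real>\<^sub>\<le>\<^sub>0"
      using Im_Ln_eq_pi[of v] by (auto simp: complex_nonpos_Reals_iff complex_eq_iff)
  next
    assume v: "v \<notin> \<real>\<^sub>\<le>\<^sub>0" "Ln v + 2 * of_int k * pi * \<i> \<notin> log_slit k"
    then have v0: "v \<noteq> 0" by auto
    have "Im (Ln v) \<noteq> pi"
      using Im_Ln_eq_pi[OF v0] v(1) by (auto simp: complex_nonpos_Reals_iff)
    then have "Im (Ln v) < pi" "- pi < Im (Ln v)"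
      using Im_Ln_le_pi[OF v0] mpi_less_Im_Ln[OF v0] by auto
    then have "Ln v + 2 * of_int k * pi * \<i> \<in> log_strip k"
      by (simp add: log_strip_def algebra_simps)
    moreover have "exp (Ln v + 2 * of_int k * pi * \<i>) = v"
    proof -
      have "exp (Ln v + 2 * of_int k * pi * \<i>) = exp (Ln v)"
        unfolding exp_eq by (intro exI[of _ k]) simp
      then show ?thesis using v0 by simp
    qed
    ultimately show "\<exists>l\<in>log_strip k. l \<notin> log_slit k \<and> v = exp l" using v(2) by metis
  qed
qed

text \<open>For \<open>k \<le> 0\<close> the exponential maps the logarithmic slit to the half-line
  from \<open>exp m\<close>, which joins the negative axis at infinity. That \<open>T\<close> is
  real later makes the image invariant under conjugation.\<close>

lemma Gamma_image_gamma_domain: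
  "\<exists>T \<subseteq> \<real>. real_slit (insert None (Some ` T)) \<and> Gamma ` gamma_domain k = - T"
proof (cases "k \<le> 0")
  case False
  then have "Gamma ` gamma_domain k = - (of_real ` {..0})"
    using Gamma_image_gamma_domain_iff[of _ k] log_slit_positive[of k]
    by (auto simp: nonpos_Reals_def)
  then show ?thesis using real_slit_through_infinity[of 1 1]
    by (intro exI[of _ "of_real ` {..0}"]) auto
next
  case True
  then obtain m where m: "log_slit k = {l. Im l = 2 * of_int k * pi \<and> m \<le> Re l}"
    using log_slit_nonpositive by blast
  have "Ln v + 2 * of_int k * pi * \<i> \<in> log_slit k \<longleftrightarrow> v \<in> of_real ` {exp m..}" if "v \<notin> \<real>\<^sub>\<le>\<^sub>0" for v
  proof -
    have v0: "v \<noteq> 0" using that by auto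
    have "Ln v + 2 * of_int k * pi * \<i> \<in> log_slit k \<longleftrightarrow> Im (Ln v) = 0 \<and> m \<le> ln (norm v)"
      using v0 by (simp add: m)
    also have "\<dots> \<longleftrightarrow> (0 < Re v \<and> Im v = 0) \<and> exp m \<le> norm v"
      using Im_Ln_eq_0[OF v0] v0 by (simp add: ln_ge_iff)
    also have "\<dots> \<longleftrightarrow> v \<in> of_real ` {exp m..}"
    proof
      assume "(0 < Re v \<and> Im v = 0) \<and> exp m \<le> norm v"
      then have "v = of_real (Re v)" "exp m \<le> Re v" by (auto simp: complex_eq_iff cmod_def)
      then show "v \<in> of_real ` {exp m..}" by (metis atLeast_iff imageI)
    qed (auto intro: less_le_trans[OF exp_gt_zero] order.trans[OF _ abs_ge_self])
    finally show ?thesis .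
  qed
  then have "v \<in> Gamma ` gamma_domain k \<longleftrightarrow> v \<notin> \<real>\<^sub>\<le>\<^sub>0 \<and> v \<notin> of_real ` {exp m..}" for v
    unfolding Gamma_image_gamma_domain_iff by blast
  then have "Gamma ` gamma_domain k = - (of_real ` ({..0} \<union> {exp m..}))"
    unfolding nonpos_Reals_def atMost_def by blast
  then show ?thesis using real_slit_through_infinity[of "exp m" 2]
    by (intro exI[of _ "of_real ` ({..0} \<union> {exp m..})"]) auto
qed

text \<open>Even when the logarithm \<open>l\<close> of \<open>v\<close> lies on the slit or on the
  upper edge, it is a limit of points of the slit strip. Their preimages subconverge to a point of
  the closure with value \<open>v\<close>.\<close>

lemma Gamma_attained_on_closure:
  assumes "v \<noteq> 0"
  shows "\<exists>z\<in>closure (gamma_domain k). z \<notin> \<int>\<^sub>\<le>\<^sub>0 \<and> Gamma z = v"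
proof -
  define l where "l = Ln v + 2 * of_int k * pi * \<i>"
  have "exp l = exp (Ln v)" unfolding l_def exp_eq by (intro exI[of _ k]) simp
  then have l: "exp l = v" using assms by simp
  have Iml: "(2 * of_int k - 1) * pi < Im l" "Im l \<le> (2 * of_int k + 1) * pi"
    using mpi_less_Im_Ln[OF assms] Im_Ln_le_pi[OF assms] by (auto simp: l_def algebra_simps)
  \<comment> \<open>The direction of approach: upwards from the line of the slit, downwards from the
    upper edge, constant otherwise. Steps of length at most \<open>1 < pi\<close> stay in the strip
    and off the slit.\<close>
  define s :: real where "s = (if Im l = 2 * of_int k * pi then 1 else if Im l = (2 * of_int k + 1) * pi then - 1 else 0)"
  define ls where "ls n = l + of_real (s / real (Suc n)) * \<i>" for n
  have "\<exists>z. z \<in> gamma_domain k \<and> ln_Gamma z = ls n" for n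
  proof -
    define e where "e = 1 / real (Suc n)"
    have "0 < e" "e \<le> 1" by (auto simp: e_def)
    moreover have "1 < pi" using pi_gt3 by linarith
    moreover have "Im (ls n) = Im l + s * e" by (simp add: ls_def e_def)
    ultimately have "(2 * of_int k - 1) * pi < Im (ls n)" "Im (ls n) < (2 * of_int k + 1) * pi"
      "Im (ls n) \<noteq> 2 * of_int k * pi"
      using Iml unfolding s_def by (auto simp: algebra_simps split: if_splits)
    then show ?thesis using gamma_domain_preimage by metis
  qed
  then obtain z where z: "\<And>n. z n \<in> gamma_domain k" "\<And>n. ln_Gamma (z n) = ls n" by metis
  have "(\<lambda>n. s / real (Suc n)) \<longlonglongrightarrow> 0"
    by (rule LIMSEQ_Suc[OF lim_const_over_n])
  then have "ls \<longlonglongrightarrow> l + of_real 0 * \<i>" unfolding ls_def by (intro tendsto_intros)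
  then have "(\<lambda>n. ln_Gamma (z n)) \<longlonglongrightarrow> l" by (simp add: z(2))
  moreover have "0 < Im (z n)" for n using z(1) gamma_domain_subset by auto
  ultimately obtain w r where w: "(\<lambda>n. z (r n)) \<longlonglongrightarrow> w" "w \<notin> \<int>\<^sub>\<le>\<^sub>0" "rGamma w = exp (- l)"
    using ln_Gamma_preimage_limit by metis
  have "w \<in> closure (gamma_domain k)"
    unfolding closure_sequential using z(1) w(1) by (intro exI[of _ "\<lambda>n. z (r n)"]) auto
  moreover have "Gamma w = v" using w(3) l by (simp add: Gamma_def exp_minus)
  ultimately show ?thesis using w by blast
qed

text \<open>Just to the right of the pole \<open>2 * k\<close> the boundary values lie inside the
  open strip, so nearby points of the upper half plane belong to the domain; the pole is a limit of
  such real points.\<close>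

lemma pole_in_closure_gamma_domain:
  assumes "k \<le> 0"
  shows "of_int (2 * k) \<in> closure (gamma_domain k)"
proof -
  have *: "of_real x \<in> closure (gamma_domain k)" if x: "of_int (2 * k) < x" "x < of_int (2 * k) + 1" for x :: real
  proof (rule ccontr)
    assume nin: "of_real x \<notin> closure (gamma_domain k)"
    have floor: "\<lfloor>x\<rfloor> = 2 * k" using x by (simp add: floor_eq_iff)
    have np: "x \<notin> \<int>\<^sub>\<le>\<^sub>0" using x by (rule notin_nonpos_Ints_between)
    have "ln_Gamma_boundary x \<in> log_strip k"
      using ln_Gamma_boundary_in_strip_iff[of x k] floor assms by simp
    from topological_tendstoD[OF tendsto_ln_Gamma_boundary[OF np] open_log_strip this]
    have 1: "\<forall>\<^sub>F z in at (of_real x) within upper_half_plane. ln_Gamma z \<in> log_strip k" .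
    have 2: "\<forall>\<^sub>F z in at (of_real x) within upper_half_plane. z \<in> - closure (gamma_domain k)"
      using nin by (intro topological_tendstoD[OF tendsto_ident_at]) auto
    have 3: "\<forall>\<^sub>F z in at (of_real x) within upper_half_plane. z \<in> upper_half_plane"
      by (simp add: eventually_at_filter)
    from 1 2 3 have "\<forall>\<^sub>F z in at (of_real x) within upper_half_plane. False"
      by eventually_elim (use closure_subset[of "gamma_domain k"] in \<open>auto simp: gamma_domain_def\<close>)
    then show False using at_within_upper_half_plane_nontrivial by simp
  qed
  \<comment> \<open>The shift \<open>n + 2\<close> keeps the fraction strictly below 1.\<close>
  have lim: "(\<lambda>n. of_real (of_int (2 * k) + 1 / real (n + 2)) :: complex) \<longlonglongrightarrow> of_real (of_int (2 * k) + 0)"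
    by (intro tendsto_intros LIMSEQ_ignore_initial_segment[OF lim_1_over_n])
  have "of_real (of_int (2 * k) + 1 / real (n + 2)) \<in> closure (gamma_domain k)" for n
    by (rule *) auto
  from closed_sequentially[OF closed_closure this lim]
  have "(of_real (of_int (2 * k) + 0) :: complex) \<in> closure (gamma_domain k)" .
  then show ?thesis by simp
qed

text \<open>A path along which \<open>ln_Gamma\<close> has constant imaginary part \<open>2 k pi > 0\<close> cannot accumulate at a
  pole, because there the upper limit of \<open>Im (ln_Gamma z)\<close> is at most 0.\<close>

lemma asymptotic_path_gamma_domain:
  assumes "0 < k"
  obtains \<gamma> :: "real \<Rightarrow> complex" where "continuous_on {0..} \<gamma>" "\<gamma> ` {0..} \<subseteq> gamma_domain k"
    "filterlim \<gamma> at_infinity at_top" "filterlim (\<lambda>t. Gamma (\<gamma> t)) at_infinity at_top"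
proof -
  obtain g where g: "homeomorphism (gamma_domain k) (log_strip k - log_slit k) ln_Gamma g"
    using homeomorphism_gamma_domain by blast
  define c where "c = 2 * of_int k * pi"
  define \<gamma> where "\<gamma> t = g (Complex t c)" for t
  have c: "c > 0" using assms by (simp add: c_def)
  have line: "Complex t c \<in> log_strip k - log_slit k" for t
    using log_slit_positive[OF assms] by (auto simp: log_strip_def c_def)
  have \<gamma>: "\<gamma> t \<in> gamma_domain k" "ln_Gamma (\<gamma> t) = Complex t c" for t
    using g line[of t] unfolding \<gamma>_def homeomorphism_def by auto
  have Im_pos: "0 < Im (\<gamma> t)" for t using \<gamma>(1) gamma_domain_subset by auto
  have norm_rGamma: "norm (rGamma (\<gamma> t)) = exp (- t)" for t
    using exp_minus_ln_Gamma[OF Im_pos[of t]] \<gamma>(2)[of t] by (metis Re_complex_of_real complex.sel(1) norm_exp_eq_Re uminus_complex.sel(1))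
  have "continuous_on {0..} \<gamma>"
    unfolding \<gamma>_def
  proof (rule continuous_on_compose2[of "log_strip k - log_slit k" g])
    show "continuous_on (log_strip k - log_slit k) g" using g by (simp add: homeomorphism_def)
    show "continuous_on {0..} (\<lambda>t. Complex t c)"
      unfolding Complex_eq by (intro continuous_intros)
  qed (use line in blast)
  moreover have "filterlim (\<lambda>t. Gamma (\<gamma> t)) at_infinity at_top"
  proof -
    have "norm (Gamma (\<gamma> t)) = exp t" for t
      using norm_rGamma[of t] by (simp add: rGamma_inverse_Gamma norm_inverse exp_minus)
    then show ?thesis
      by (simp add: filterlim_at_infinity_conv_norm_at_top exp_at_top)
  qed
  moreover have "filterlim \<gamma> at_infinity at_top"
  proof (rule ccontr)
    \<comment> \<open>Otherwise the path has a finite limit point \<open>w\<close> for parameters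
      tending to infinity, and \<open>norm (rGamma (\<gamma> t)) = exp (- t)\<close> forces
      \<open>w\<close> to be a pole.\<close>
    assume "\<not> filterlim \<gamma> at_infinity at_top"
    then obtain R where R: "\<exists>\<^sub>F t in at_top. norm (\<gamma> t) \<le> R"
      by (auto simp: filterlim_at_infinity_conv_norm_at_top filterlim_at_top_dense not_eventually not_less)
    have "\<exists>t. real n \<le> t \<and> norm (\<gamma> t) \<le> R" for n
      using frequently_eventually_conj[OF R eventually_ge_at_top[of "real n"]]
      by (auto dest: frequently_ex)
    then obtain t where t: "\<And>n. real n \<le> t n" "\<And>n. norm (\<gamma> (t n)) \<le> R" by metis
    have "bounded (range (\<lambda>n. \<gamma> (t n)))" using t(2) by (auto simp: bounded_iff)
    then obtain w r where r: "strict_mono r" "((\<lambda>n. \<gamma> (t n)) \<circ> r) \<longlonglongrightarrow> w"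
      using bounded_imp_convergent_subsequence by blast
    then have lim: "(\<lambda>n. \<gamma> (t (r n))) \<longlonglongrightarrow> w" by (simp add: o_def)
    have "(\<lambda>n. norm (rGamma (\<gamma> (t (r n))))) \<longlonglongrightarrow> norm (rGamma w)"
      by (intro tendsto_norm isCont_tendsto_compose[OF isCont_rGamma[OF continuous_ident] lim])
    moreover have "(\<lambda>n. norm (rGamma (\<gamma> (t (r n))))) \<longlonglongrightarrow> 0"
    proof (rule tendsto_sandwich[OF _ _ tendsto_const])
      show "(\<lambda>n. exp (- real n)) \<longlonglongrightarrow> 0"
        by (rule filterlim_compose[OF exp_at_bot filterlim_compose[OF filterlim_uminus_at_bot_at_top filterlim_real_sequentially]])
      have "real n \<le> t (r n)" for n
        using seq_suble[OF r(1), of n] t(1)[of "r n"] by linarith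
      then show "\<forall>\<^sub>F n in sequentially. norm (rGamma (\<gamma> (t (r n)))) \<le> exp (- real n)"
        by (simp add: norm_rGamma)
    qed simp
    ultimately have "rGamma w = 0" using LIMSEQ_unique by fastforce
    then have w: "w \<in> \<int>\<^sub>\<le>\<^sub>0" by (simp add: rGamma_eq_zero_iff)
    then have "Im w = 0" by (auto elim: nonpos_Ints_cases)
    then have "filterlim (\<lambda>n. \<gamma> (t (r n))) (at w within upper_half_plane) sequentially"
      using lim Im_pos unfolding filterlim_at by (auto intro!: always_eventually) (metis less_irrefl)
    from eventually_compose_filterlim[OF Im_ln_Gamma_near_pole[OF w c] this]
    have "\<forall>\<^sub>F n in sequentially. Im (ln_Gamma (\<gamma> (t (r n)))) < c" .
    then show False by (simp add: \<gamma>(2))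
  qed
  ultimately show thesis using that \<gamma>(1) by blast
qed

section \<open>Local finiteness of the domains and covering of the closed upper half plane\<close>

lemma finite_gamma_domains_meeting_bounded:
  assumes "bounded K"
  shows "finite {k. gamma_domain k \<inter> K \<noteq> {}}"
proof -
  obtain R where R: "\<And>z. z \<in> K \<Longrightarrow> norm z \<le> R" using assms by (auto simp: bounded_iff)
  obtain C where C: "\<And>z. 0 < Im z \<Longrightarrow> norm z \<le> R \<Longrightarrow> \<bar>Im (ln_Gamma z)\<bar> \<le> C"
    using Im_ln_Gamma_bounded by blast
  have "\<bar>k\<bar> \<le> \<lceil>C\<rceil> + 1" if meet: "gamma_domain k \<inter> K \<noteq> {}" for k
  proof -
    obtain z where z: "z \<in> gamma_domain k" "z \<in> K" using meet by blast
    then have "\<bar>Im (ln_Gamma z)\<bar> \<le> C" using C R gamma_domain_subset by blast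
    moreover have "(2 * of_int k - 1) * pi < Im (ln_Gamma z)" "Im (ln_Gamma z) < (2 * of_int k + 1) * pi"
      using z by (auto simp: gamma_domain_def log_strip_def)
    ultimately have "(2 * of_int k - 1) * pi < C" "(- 2 * of_int k - 1) * pi < C" "0 \<le> C"
      by (auto simp: algebra_simps)
    \<comment> \<open>Applied to \<open>k\<close> and to \<open>- k\<close>, this bounds
      \<open>k\<close> on both sides.\<close>
    have less: "of_int j \<le> C + 1" if "(2 * of_int j - 1) * pi < C" for j
    proof (cases "j \<ge> 1")
      case True
      then have "(2 * real_of_int j - 1) * 1 \<le> (2 * of_int j - 1) * pi"
        using pi_gt3 by (intro mult_left_mono) auto
      with that have "2 * real_of_int j - 1 < C" by simp
      then show ?thesis using True by simp
    qed (use \<open>0 \<le> C\<close> in auto)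
    from less[of k] less[of "- k"] have "of_int \<bar>k\<bar> \<le> C + 1"
      using \<open>(2 * of_int k - 1) * pi < C\<close> \<open>(- 2 * of_int k - 1) * pi < C\<close> by auto
    then show ?thesis by linarith
  qed
  then have "{k. gamma_domain k \<inter> K \<noteq> {}} \<subseteq> {- (\<lceil>C\<rceil> + 1)..\<lceil>C\<rceil> + 1}" by fastforce
  then show ?thesis by (rule finite_subset) simp
qed

text \<open>\<open>ln_Gamma\<close> is an open map, so near \<open>z\<close> there are points whose
  logarithm lies slightly lower; this moves a logarithm on an edge into the strip below.\<close>

lemma upper_half_plane_covered:
  assumes "0 < Im z"
  shows "\<exists>k. z \<in> closure (gamma_domain k)"
proof -
  define a where "a = Im (ln_Gamma z) / pi"
  \<comment> \<open>The ceiling selects the strip that includes its upper edge and excludes its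
    lower one.\<close>
  define k where "k = \<lceil>(a - 1) / 2\<rceil>"
  have "(a - 1) / 2 \<le> of_int k" "of_int k < (a - 1) / 2 + 1"
    unfolding k_def by linarith+
  then have "a \<le> 2 * of_int k + 1" "2 * of_int k - 1 < a"
    by (simp_all add: field_simps)
  then have k: "Im (ln_Gamma z) \<le> (2 * of_int k + 1) * pi" "(2 * of_int k - 1) * pi < Im (ln_Gamma z)"
    by (simp_all add: a_def divide_le_eq less_divide_eq)
  have "z \<in> closure (gamma_domain k)"
    unfolding closure_approachable
  proof (intro allI impI)
    fix e :: real assume "e > 0"
    have "open (ln_Gamma ` (ball z e \<inter> upper_half_plane))"
      by (intro open_ln_Gamma_image open_Int open_upper_half_plane) auto
    moreover have "ln_Gamma z \<in> ln_Gamma ` (ball z e \<inter> upper_half_plane)"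
      using assms \<open>e > 0\<close> by auto
    ultimately obtain d where d: "d > 0" "ball (ln_Gamma z) d \<subseteq> ln_Gamma ` (ball z e \<inter> upper_half_plane)"
      using openE by blast
    \<comment> \<open>Small enough to stay in the ball and above the lower edge of the
      strip.\<close>
    define h where "h = min (d / 2) (min 1 ((Im (ln_Gamma z) - (2 * of_int k - 1) * pi) / 2))"
    have less: "min (d / 2) (min 1 (b / 2)) < b" if "0 < b" for b :: real using that by linarith
    have h: "0 < h" "h < d" "h < Im (ln_Gamma z) - (2 * of_int k - 1) * pi"
      unfolding h_def using d k less by auto
    have "ln_Gamma z - of_real h * \<i> \<in> ball (ln_Gamma z) d"
      using h by (simp add: dist_norm norm_mult)
    with d(2) have "ln_Gamma z - of_real h * \<i> \<in> ln_Gamma ` (ball z e \<inter> upper_half_plane)" by blast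
    then obtain u where u: "u \<in> ball z e" "0 < Im u" "ln_Gamma u = ln_Gamma z - of_real h * \<i>"
      by (auto simp del: mem_ball)
    have "ln_Gamma u \<in> log_strip k" using u(3) h k by (simp add: log_strip_def)
    then have "u \<in> gamma_domain k" using u by (simp add: gamma_domain_def)
    then show "\<exists>y\<in>gamma_domain k. dist y z < e" using u(1) by (auto simp: dist_commute)
  qed
  then show ?thesis ..
qed

text \<open>Points approaching \<open>x\<close> from above lie in the closures of the finitely many
  domains that meet a fixed disc, and the union of these closures is closed.\<close>

lemma real_line_covered: "\<exists>k. of_real x \<in> closure (gamma_domain k)"
proof -
  define F where "F = {k. gamma_domain k \<inter> ball (of_real x) 2 \<noteq> {}}"
  have "finite F" unfolding F_def by (intro finite_gamma_domains_meeting_bounded) auto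
  define u where "u n = Complex x (1 / real (n + 2))" for n
  have "u n \<in> (\<Union>k\<in>F. closure (gamma_domain k))" for n
  proof -
    obtain k where k: "u n \<in> closure (gamma_domain k)"
      using upper_half_plane_covered[of "u n"] by (auto simp: u_def)
    have "u n \<in> ball (of_real x) 2" by (simp add: u_def dist_norm cmod_def divide_less_eq)
    then have "gamma_domain k \<inter> ball (of_real x) 2 \<noteq> {}"
      using k open_Int_closure_eq_empty[of "ball (of_real x) 2" "gamma_domain k"] by blast
    then show ?thesis using k by (auto simp: F_def)
  qed
  moreover have "closed (\<Union>k\<in>F. closure (gamma_domain k))"
    using \<open>finite F\<close> by (intro closed_UN) auto
  moreover have "u \<longlonglongrightarrow> of_real x"
  proof -
    have "(\<lambda>n. of_real x + \<i> * of_real (1 / real (n + 2))) \<longlonglongrightarrow> of_real x + \<i> * of_real 0"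
      by (intro tendsto_intros LIMSEQ_ignore_initial_segment[OF lim_1_over_n])
    then show ?thesis by (simp add: u_def[abs_def] Complex_eq)
  qed
  ultimately have "of_real x \<in> (\<Union>k\<in>F. closure (gamma_domain k))"
    using closed_sequentially by blast
  then show ?thesis by blast
qed

text \<open>Off the real axis there are no poles, so the finite chart suffices, and the derivative
  is \<open>Gamma z * Digamma z\<close>.\<close>

lemma conformal_Gamma_sphere:
  assumes "Im z \<noteq> 0"
  shows "conformal_to_sphere_at Gamma_sphere z"
proof -
  have np: "x \<notin> \<int>\<^sub>\<le>\<^sub>0" if "Im x \<noteq> 0" for x :: complex
    using that by (auto elim!: nonpos_Ints_cases)
  have "open {x. Im x \<noteq> 0}" by (intro open_Collect_neq continuous_intros)
  then have "\<forall>\<^sub>F x in nhds z. x \<in> {x. Im x \<noteq> 0}" using assms by (intro eventually_nhds_in_open) auto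
  then have "\<forall>\<^sub>F x in nhds z. Gamma_sphere x = Some (Gamma x)"
    by eventually_elim (use np in \<open>auto simp: Gamma_sphere_def\<close>)
  moreover have "deriv Gamma z = Gamma z * Digamma z"
    by (intro DERIV_imp_deriv has_field_derivative_Gamma np assms)
  moreover have "Gamma z * Digamma z \<noteq> 0"
    using np[OF assms] Digamma_nonzero[OF assms] by (simp add: Gamma_eq_zero_iff)
  moreover have "Gamma analytic_on {z}" using np[OF assms] by (intro analytic_Gamma) auto
  moreover have "Gamma_sphere z \<noteq> None" using np[OF assms] by (simp add: Gamma_sphere_def)
  ultimately show ?thesis unfolding conformal_to_sphere_at_def by auto
qed

lemma Gamma_surjective_on_closure_criterion:
  assumes "\<And>v. v \<noteq> 0 \<Longrightarrow> \<exists>z\<in>closure U. z \<notin> \<int>\<^sub>\<le>\<^sub>0 \<and> Gamma z = v" and "\<not> bounded U" and "U \<inter> \<int>\<^sub>\<le>\<^sub>0 = {}"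
    and "closure U \<inter> \<int>\<^sub>\<le>\<^sub>0 \<noteq> {} \<or> (\<exists>\<gamma>::real \<Rightarrow> complex. continuous_on {0..} \<gamma> \<and> \<gamma> ` {0..} \<subseteq> U \<and>
          filterlim \<gamma> at_infinity at_top \<and> filterlim (\<lambda>t. Gamma (\<gamma> t)) at_infinity at_top)"
  shows "Gamma_surjective_on_closure U"
  unfolding Gamma_surjective_on_closure_def Some_in_sphere_closure_iff
proof (intro conjI allI impI ballI)
  show "Gamma_sphere z \<in> UNIV - {Some 0}" for z
    by (simp add: Gamma_sphere_def Gamma_eq_zero_iff)
next
  fix w assume w: "w \<in> UNIV - {Some (0::complex)}"
  show "(\<exists>z. z \<in> closure U \<and> Gamma_sphere z = w) \<or>
      w = None \<and> None \<in> sphere_closure U \<and> asymptotic_value_in Gamma_sphere U None"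
  proof (cases w)
    case (Some v)
    then have "v \<noteq> 0" using w by auto
    from assms(1)[OF this] Some show ?thesis by (auto simp: Gamma_sphere_def)
  next
    case None
    from assms(4) show ?thesis
    proof
      assume "closure U \<inter> \<int>\<^sub>\<le>\<^sub>0 \<noteq> {}"
      then show ?thesis using None by (auto simp: Gamma_sphere_def)
    next
      assume "\<exists>\<gamma>::real \<Rightarrow> complex. continuous_on {0..} \<gamma> \<and> \<gamma> ` {0..} \<subseteq> U \<and>
          filterlim \<gamma> at_infinity at_top \<and> filterlim (\<lambda>t. Gamma (\<gamma> t)) at_infinity at_top"
      then obtain \<gamma> :: "real \<Rightarrow> complex" where \<gamma>: "continuous_on {0..} \<gamma>" "\<gamma> ` {0..} \<subseteq> U"
        "filterlim \<gamma> at_infinity at_top" "filterlim (\<lambda>t. Gamma (\<gamma> t)) at_infinity at_top" by blast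
      have "\<forall>\<^sub>F t in at_top. Some (Gamma (\<gamma> t)) = Gamma_sphere (\<gamma> t)"
        using eventually_ge_at_top[of 0]
        by eventually_elim (use \<gamma>(2) assms(3) in \<open>auto simp: Gamma_sphere_def\<close>)
      then have "limitin riemann_sphere (\<lambda>t. Gamma_sphere (\<gamma> t)) None at_top"
        using limitin_riemann_sphere_None[OF \<gamma>(4)] by (rule limitin_transform_eventually)
      then have "asymptotic_value_in Gamma_sphere U None"
        unfolding asymptotic_value_in_def using \<gamma> by blast
      then show ?thesis using None None_in_sphere_closure[OF assms(2)] by simp
    qed
  qed
qed

subsection \<open>Complex conjugation and the theorem\<close>

context
  fixes \<sigma> :: "complex \<Rightarrow> complex"
  assumes \<sigma>: "\<sigma> = id \<or> \<sigma> = cnj"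
begin

text \<open>With \<open>\<sigma>\<close> the identity or conjugation, a domain and its mirror image
  are treated at once.\<close>

lemma id_or_cnj_simps: "\<sigma> (\<sigma> z) = z" "norm (\<sigma> z) = norm z" "Gamma (\<sigma> z) = \<sigma> (Gamma z)"
    "\<sigma> z \<in> \<int>\<^sub>\<le>\<^sub>0 \<longleftrightarrow> z \<in> \<int>\<^sub>\<le>\<^sub>0" "\<sigma> z = 0 \<longleftrightarrow> z = 0" "Im (\<sigma> z) = 0 \<longleftrightarrow> Im z = 0"
proof -
  have "cnj z \<in> \<int>\<^sub>\<le>\<^sub>0" if "z \<in> \<int>\<^sub>\<le>\<^sub>0" for z
    using that by (auto elim!: nonpos_Ints_cases intro: nonpos_Ints_of_int)
  then have "cnj z \<in> \<int>\<^sub>\<le>\<^sub>0 \<longleftrightarrow> z \<in> \<int>\<^sub>\<le>\<^sub>0" by (metis complex_cnj_cnj)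
  then show "\<sigma> (\<sigma> z) = z" "norm (\<sigma> z) = norm z" "Gamma (\<sigma> z) = \<sigma> (Gamma z)"
    "\<sigma> z \<in> \<int>\<^sub>\<le>\<^sub>0 \<longleftrightarrow> z \<in> \<int>\<^sub>\<le>\<^sub>0" "\<sigma> z = 0 \<longleftrightarrow> z = 0" "Im (\<sigma> z) = 0 \<longleftrightarrow> Im z = 0"
    using \<sigma> by (auto simp: cnj_Gamma)
qed

lemma id_or_cnj_Reals: "z \<in> \<real> \<Longrightarrow> \<sigma> z = z"
  using \<sigma> by (auto elim: Reals_cases)

lemma continuous_on_id_or_cnj: "continuous_on A \<sigma>"
  using \<sigma> by (auto intro: continuous_intros simp: id_def)

lemma homeomorphic_id_or_cnj_image: "U homeomorphic \<sigma> ` U"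
  unfolding homeomorphic_def homeomorphism_def
  by (intro exI[of _ \<sigma>]) (auto simp: id_or_cnj_simps continuous_on_id_or_cnj image_image)

lemma closure_id_or_cnj_image: "closure (\<sigma> ` U) = \<sigma> ` closure U"
proof -
  have "linear \<sigma>" using \<sigma> by (auto simp: id_def bounded_linear.linear bounded_linear_cnj)
  moreover have "inj \<sigma>" by (metis injI id_or_cnj_simps(1))
  ultimately show ?thesis using closure_injective_linear_image by metis
qed

lemma id_or_cnj_image_domain:
  shows "open (\<sigma> ` gamma_domain k)" "connected (\<sigma> ` gamma_domain k)"
    "simply_connected (\<sigma> ` gamma_domain k)" "\<not> bounded (\<sigma> ` gamma_domain k)"
proof -
  have "\<sigma> ` gamma_domain k = \<sigma> -` gamma_domain k"
    by (auto simp: id_or_cnj_simps) (metis imageI id_or_cnj_simps(1))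
  then show "open (\<sigma> ` gamma_domain k)"
    using continuous_on_id_or_cnj[of UNIV] open_gamma_domain by (simp add: open_vimage)
  show sc: "simply_connected (\<sigma> ` gamma_domain k)"
    using homeomorphic_simply_connected[OF homeomorphic_id_or_cnj_image simply_connected_gamma_domain] .
  then show "connected (\<sigma> ` gamma_domain k)" by (rule simply_connected_imp_connected)
  show "\<not> bounded (\<sigma> ` gamma_domain k)"
    using unbounded_gamma_domain[of k] by (simp add: bounded_iff id_or_cnj_simps)
qed

text \<open>\<open>\<sigma>\<close> commutes with \<open>Gamma\<close> and fixes the real set
  \<open>T\<close> pointwise, so mirror domains have the same image.\<close>

lemma id_or_cnj_image_conformal:
  "\<exists>L. real_slit L \<and> maps_conformally_onto Gamma_sphere (\<sigma> ` gamma_domain k) (UNIV - L)"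
proof -
  obtain T where T: "T \<subseteq> \<real>" "real_slit (insert None (Some ` T))" "Gamma ` gamma_domain k = - T"
    using Gamma_image_gamma_domain by blast
  have Im0: "Im z \<noteq> 0" if "z \<in> \<sigma> ` gamma_domain k" for z
    using that gamma_domain_subset[of k] by (auto simp: id_or_cnj_simps)
  moreover have "Im z = 0" if "z \<in> \<int>\<^sub>\<le>\<^sub>0" for z :: complex
    using that by (auto elim!: nonpos_Ints_cases)
  ultimately have Gs: "Gamma_sphere z = Some (Gamma z)" if "z \<in> \<sigma> ` gamma_domain k" for z
    using that by (auto simp: Gamma_sphere_def)
  have "inj_on Gamma (\<sigma> ` gamma_domain k)"
  proof (rule inj_onI)
    fix z w assume "z \<in> \<sigma> ` gamma_domain k" "w \<in> \<sigma> ` gamma_domain k" "Gamma z = Gamma w"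
    moreover from this(3) have "Gamma (\<sigma> z) = Gamma (\<sigma> w)" by (simp add: id_or_cnj_simps)
    moreover from calculation have "\<sigma> z \<in> gamma_domain k" "\<sigma> w \<in> gamma_domain k"
      by (auto simp: id_or_cnj_simps)
    ultimately have "\<sigma> z = \<sigma> w" using inj_onD[OF inj_on_Gamma_gamma_domain[of k]] by blast
    then show "z = w" by (metis id_or_cnj_simps(1))
  qed
  then have "inj_on Gamma_sphere (\<sigma> ` gamma_domain k)"
    by (simp add: Gs inj_on_def)
  moreover have "Gamma_sphere ` \<sigma> ` gamma_domain k = UNIV - insert None (Some ` T)"
  proof -
    have "Gamma_sphere ` \<sigma> ` gamma_domain k = Some ` \<sigma> ` Gamma ` gamma_domain k"
      unfolding image_image by (intro image_cong refl) (simp add: Gs id_or_cnj_simps)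
    also have "\<sigma> ` (- T) = - T"
    proof -
      have "\<sigma> v \<in> T \<longleftrightarrow> v \<in> T" for v
        using T(1) id_or_cnj_Reals id_or_cnj_simps(1) by (metis subsetD)
      then show ?thesis by (auto simp: id_or_cnj_simps) (metis ComplI image_eqI id_or_cnj_simps(1))
    qed
    then have "Some ` \<sigma> ` Gamma ` gamma_domain k = Some ` (- T)" unfolding T(3) by simp
    also have "\<dots> = UNIV - insert None (Some ` T)"
      by (auto simp: UNIV_option_conv)
    finally show ?thesis .
  qed
  ultimately have "maps_conformally_onto Gamma_sphere (\<sigma> ` gamma_domain k) (UNIV - insert None (Some ` T))"
    unfolding maps_conformally_onto_def bij_betw_def using Im0 conformal_Gamma_sphere by blast
  with T(2) show ?thesis by blast
qed

text \<open>Infinity is reached at the pole \<open>2 * k\<close> for \<open>k \<le> 0\<close> and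
  along an asymptotic path for \<open>k > 0\<close>.\<close>

lemma id_or_cnj_image_surjective: "Gamma_surjective_on_closure (\<sigma> ` gamma_domain k)"
proof (rule Gamma_surjective_on_closure_criterion)
  fix v :: complex assume "v \<noteq> 0"
  then obtain z where "z \<in> closure (gamma_domain k)" "z \<notin> \<int>\<^sub>\<le>\<^sub>0" "Gamma z = \<sigma> v"
    using Gamma_attained_on_closure[of "\<sigma> v" k] by (auto simp: id_or_cnj_simps)
  then show "\<exists>z\<in>closure (\<sigma> ` gamma_domain k). z \<notin> \<int>\<^sub>\<le>\<^sub>0 \<and> Gamma z = v"
    unfolding closure_id_or_cnj_image by (intro bexI[of _ "\<sigma> z"]) (auto simp: id_or_cnj_simps)
next
  show "\<not> bounded (\<sigma> ` gamma_domain k)" by (rule id_or_cnj_image_domain)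
  show "\<sigma> ` gamma_domain k \<inter> \<int>\<^sub>\<le>\<^sub>0 = {}"
    using gamma_domain_subset[of k] upper_half_plane_notin_nonpos_Ints by (auto simp: id_or_cnj_simps)
  show "closure (\<sigma> ` gamma_domain k) \<inter> \<int>\<^sub>\<le>\<^sub>0 \<noteq> {} \<or> (\<exists>\<gamma>::real \<Rightarrow> complex. continuous_on {0..} \<gamma> \<and>
      \<gamma> ` {0..} \<subseteq> \<sigma> ` gamma_domain k \<and> filterlim \<gamma> at_infinity at_top \<and>
      filterlim (\<lambda>t. Gamma (\<gamma> t)) at_infinity at_top)"
  proof (cases "k \<le> 0")
    case True
    then have "(of_int (2 * k) :: complex) \<in> \<int>\<^sub>\<le>\<^sub>0" by (intro nonpos_Ints_of_int) auto
    moreover have "of_int (2 * k) \<in> closure (\<sigma> ` gamma_domain k)"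
      unfolding closure_id_or_cnj_image using pole_in_closure_gamma_domain[OF True] id_or_cnj_Reals[of "of_int (2 * k)"]
      by (metis Reals_of_int image_eqI)
    ultimately show ?thesis by blast
  next
    case False
    then obtain \<gamma> :: "real \<Rightarrow> complex" where \<gamma>: "continuous_on {0..} \<gamma>" "\<gamma> ` {0..} \<subseteq> gamma_domain k"
      "filterlim \<gamma> at_infinity at_top" "filterlim (\<lambda>t. Gamma (\<gamma> t)) at_infinity at_top"
      using asymptotic_path_gamma_domain[of k] by auto
    then show ?thesis
      by (intro disjI2 exI[of _ "\<lambda>t. \<sigma> (\<gamma> t)"] conjI continuous_on_compose2[OF continuous_on_id_or_cnj])
         (auto simp: filterlim_at_infinity_conv_norm_at_top id_or_cnj_simps)
  qed
qed

end

section \<open>Covering of the plane and numbering of the domains\<close>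

lemma sphere_covered: "\<exists>k. z \<in> closure (gamma_domain k) \<or> z \<in> closure (cnj ` gamma_domain k)"
proof -
  consider "0 < Im z" | "Im z = 0" | "0 < Im (cnj z)" by fastforce
  then show ?thesis
  proof cases
    case 2
    then have "z = of_real (Re z)" by (simp add: complex_eq_iff)
    then show ?thesis using real_line_covered by metis
  next
    case 3
    from upper_half_plane_covered[OF this] show ?thesis
      using closure_id_or_cnj_image[of cnj] by (metis complex_cnj_cnj image_eqI)
  qed (use upper_half_plane_covered in blast)
qed

theorem theorem1:
  shows "\<exists>\<Omega> :: int \<Rightarrow> complex set.
    (\<Union>n. sphere_closure (\<Omega> n)) = UNIV \<and>
    (\<forall>n. open (\<Omega> n) \<and> connected (\<Omega> n) \<and> simply_connected (\<Omega> n) \<and> \<not> bounded (\<Omega> n)) \<and>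
    (\<forall>n. \<exists>L. real_slit L \<and> maps_conformally_onto Gamma_sphere (\<Omega> n) (UNIV - L)) \<and>
    (\<forall>U. openin riemann_sphere U \<and> None \<in> U \<longrightarrow> infinite {n. Some ` \<Omega> n \<subseteq> U}) \<and>
    (\<forall>K. compact K \<longrightarrow> finite {n. \<Omega> n \<inter> K \<noteq> {}}) \<and>
    (\<forall>n. Gamma_surjective_on_closure (\<Omega> n))"
proof -
  \<comment> \<open>Even indices number the domains in the upper half plane, odd indices their
    conjugates.\<close>
  define \<sigma> :: "int \<Rightarrow> complex \<Rightarrow> complex" where "\<sigma> n = (if even n then id else cnj)" for n
  define \<Omega> where "\<Omega> n = \<sigma> n ` gamma_domain (n div 2)" for n
  have \<sigma>: "\<sigma> n = id \<or> \<sigma> n = cnj" for n by (simp add: \<sigma>_def)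
  have \<Omega>_even: "\<Omega> (2 * k) = gamma_domain k" and \<Omega>_odd: "\<Omega> (2 * k + 1) = cnj ` gamma_domain k" for k
    by (simp_all add: \<Omega>_def \<sigma>_def)
  have domain: "open (\<Omega> n)" "connected (\<Omega> n)" "simply_connected (\<Omega> n)" "\<not> bounded (\<Omega> n)" for n
    unfolding \<Omega>_def by (intro id_or_cnj_image_domain[OF \<sigma>])+
  have cover: "w \<in> (\<Union>n. sphere_closure (\<Omega> n))" for w
  proof (cases w)
    case None
    then show ?thesis using None_in_sphere_closure[OF domain(4)] by blast
  next
    case (Some z)
    obtain k where "z \<in> closure (\<Omega> (2 * k)) \<or> z \<in> closure (\<Omega> (2 * k + 1))"
      using sphere_covered[of z] unfolding \<Omega>_even \<Omega>_odd by blast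
    then show ?thesis using Some Some_in_sphere_closure_iff by blast
  qed
  have finite: "finite {n. \<Omega> n \<inter> K \<noteq> {}}" if "compact K" for K
  proof -
    define F where "F = {k. gamma_domain k \<inter> (K \<union> cnj ` K) \<noteq> {}}"
    have "bounded (K \<union> cnj ` K)"
      using that by (intro compact_imp_bounded compact_Un compact_continuous_image continuous_intros)
    then have "finite F" unfolding F_def by (rule finite_gamma_domains_meeting_bounded)
    moreover have "{n. \<Omega> n \<inter> K \<noteq> {}} \<subseteq> (\<lambda>k. 2 * k) ` F \<union> (\<lambda>k. 2 * k + 1) ` F"
    proof
      fix n assume "n \<in> {n. \<Omega> n \<inter> K \<noteq> {}}"
      then obtain z where z: "z \<in> gamma_domain (n div 2)" "\<sigma> n z \<in> K" by (auto simp: \<Omega>_def)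
      have "z \<in> K \<union> cnj ` K"
        using z(2) by (auto simp: \<sigma>_def split: if_splits) (metis complex_cnj_cnj image_eqI)
      then have "n div 2 \<in> F" using z(1) by (auto simp: F_def)
      moreover have "n = 2 * (n div 2) \<or> n = 2 * (n div 2) + 1" by presburger
      ultimately show "n \<in> (\<lambda>k. 2 * k) ` F \<union> (\<lambda>k. 2 * k + 1) ` F" by blast
    qed
    ultimately show ?thesis by (meson finite_UnI finite_imageI finite_subset)
  qed
  \<comment> \<open>A neighbourhood of infinity omits only a compact set, which meets finitely many
    domains; all the others lie in the neighbourhood.\<close>
  have infinite: "infinite {n. Some ` \<Omega> n \<subseteq> U}" if U: "openin riemann_sphere U" "None \<in> U" for U
  proof
    assume fin: "finite {n. Some ` \<Omega> n \<subseteq> U}"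
    obtain K where K: "compact K" "U = - Some ` K" using openin_riemann_sphere_None[OF U] by blast
    have "UNIV = {n. Some ` \<Omega> n \<subseteq> U} \<union> {n. \<Omega> n \<inter> K \<noteq> {}}" unfolding K(2) by blast
    then have "finite (UNIV :: int set)" using fin finite[OF K(1)] by (metis finite_UnI)
    then show False by simp
  qed
  show ?thesis
  proof (intro exI[of _ \<Omega>] conjI allI impI)
    show "(\<Union>n. sphere_closure (\<Omega> n)) = UNIV" using cover by blast
    show "\<exists>L. real_slit L \<and> maps_conformally_onto Gamma_sphere (\<Omega> n) (UNIV - L)" for n
      unfolding \<Omega>_def by (rule id_or_cnj_image_conformal[OF \<sigma>])
    show "Gamma_surjective_on_closure (\<Omega> n)" for n
      unfolding \<Omega>_def by (rule id_or_cnj_image_surjective[OF \<sigma>])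
  qed (use domain finite infinite in auto)
qed

end
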